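(* Let $\mathcal{P}^*$ be an equivalence class of $N$-polygons, let $\mathcal{O}\subset\mathcal{P}^*$ be open, let $T_*\in(0,\infty]$, $0<T<T_*$, and let $F:\mathcal{O}\times[0,T_* )\to\mathbb{R}^N$ be continuous and locally Lipschitz in the polygon variable (in the sense of the context). Let $k=0$, $1$ or $2$, let $\Gamma^*\in\mathcal{O}$, and suppose that $\{\Gamma(t)\}_{0\le t\le T}\subset\mathcal{O}$ is a $C^{k+1}$-class polygonal motion with $V_j(t)=F_j(\Gamma(t),t)$ for all $t\in[0,T]$, $j=1,\dots,N$, and $\Gamma(0)=\Gamma^*$. Then there exist $\delta^*>0$, $\tau^*>0$, $C>0$ and a non-decreasing function $\omega(a)>0$ with $$\omega(a)=\begin{cases} o(a^k) & \text{if } k=0 \text{ or } 1,\\ O(a^2) & \text{if } k=2,\end{cases}\qquad\text{as } a\downarrow 0,$$ such that, for time steps $0=t_0<t_1<\dots<t_{\bar m}\le T$ with $\tau_m:=t_{m+1}-t_m$ and $\tau:=\max_{0\le m<\bar m}\tau_m$, and an initial polygon $\Gamma^0\in\mathcal{O}$: if $d(\Gamma^*,\Gamma^0)\le\delta^*$ and $\tau\le\tau^*$, then polygons $\Gamma^m\in\mathcal{O}$ $(m=1,2,\dots,\bar m)$ are inductively determined by the implicit scheme $$\frac{h_j(\Gamma^{m+1})-h_j(\Gamma^m)}{\tau_m}=F_j\left(\Gamma^{m+1/2},t_{m+1/2}\right)\quad(j=1,\dots,N,\ m=0,\dots,\bar m-1),$$ where $\Gamma^{m+1/2}:=\frac{\Gamma^m+\Gamma^{m+1}}{2}$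 and $t_{m+1/2}:=\frac{t_m+t_{m+1}}{2}$, and $$\max_{0\le m\le\bar m} d(\Gamma(t_m),\Gamma^m)\le\omega(\tau)+C\,d(\Gamma(0),\Gamma^0)$$ holds.
   Context: Polygons. $\mathcal{P}$ is the set of polygonal Jordan curves in $\mathbb{R}^2$. An $N$-polygon $\Gamma\in\mathcal{P}$ has vertices $w_1,\dots,w_N$, numbered counterclockwise (indices mod $N$), edges $\Gamma_j=\{(1-\theta)w_{j-1}+\theta w_j;\ 0<\theta<1\}$ of length $|\Gamma_j|=|w_j-w_{j-1}|$, unit tangents $\mathbf{t}_j=(w_j-w_{j-1})/|\Gamma_j|$, outward unit normals $\mathbf{n}_j$ (with $\det(\mathbf{n}_j,\mathbf{t}_j)=1$), outer angles $\varphi_j\in(-\pi,\pi)\setminus\{0\}$ at $w_j$, and heights $h_j(\Gamma):=w_j\cdot\mathbf{n}_j$. Equivalence class. $\Gamma\sim\Sigma$ if they have the same number $N$ of edges and $\mathbf{n}_j(\Gamma)=\mathbf{n}_j(\Sigma)$ for all $j$ after a suitable counterclockwise numbering. $\mathcal{P}^*$ is the equivalence class of a fixed $N$-polygon; its members are always numbered so that their $j$th normals agree. Put $\mathbf{h}(\Gamma)=(h_1(\Gamma),\dots,h_N(\Gamma))^{\rm T}\in\mathbb{R}^N$. The metric on $\mathcal{P}^*$ is $d(\Gamma,\Sigma)=\max_j|h_j(\Gamma)-h_j(\Sigma)|$. For $\Gamma,\Sigma\in\mathcal{P}^*$, $\frac{\Gamma+\Sigma}{2}$ denotes the polygon in $\mathcal{P}^*$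 (if it exists) whose height vector is $\frac{1}{2}(\mathbf{h}(\Gamma)+\mathbf{h}(\Sigma))$. Polygonal motion. A $C^k$-class polygonal motion in $\mathcal{P}^*$ on an interval is a family $\Gamma(t)\in\mathcal{P}^*$ whose vertices are $C^k$ functions of $t$ (equivalently all $h_j(t)=h_j(\Gamma(t))$ are $C^k$). For a $C^1$-class polygonal motion, the outward normal velocity is constant on each edge and equals $V_j(t)=\dot h_j(t)$. Local Lipschitz condition on $F$: for every compact $\mathcal{K}\subset\mathcal{O}$ and every $T'\in(0,T_* )$ there is $L(\mathcal{K},T')>0$ such that $|F(\Gamma,t)-F(\Sigma,t)|_\infty\le L(\mathcal{K},T')\,d(\Gamma,\Sigma)$ for all $\Gamma,\Sigma\in\mathcal{K}$, $t\in[0,T']$, where $|\cdot|_\infty$ is the maximum norm. *)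

theory Defs
  imports "HOL-Complex_Analysis.Complex_Analysis" "HOL-Library.Landau_Symbols"
begin

text \<open>
  The plane is \<^typ>\<open>complex\<close>, with its real inner product. A numbered \<open>N\<close>-polygon with vertices
  \<open>w\<^sub>1, \<dots>, w\<^sub>N\<close> is the list \<open>[w\<^sub>N, w\<^sub>1, \<dots>, w\<^bsub>N-1\<^esub>]\<close> of length \<open>N\<close>, so that
  \<open>w\<^sub>j\<close> is the entry at position \<open>j mod N\<close>, and \<open>w\<^sub>0 = w\<^sub>N\<close>, \<open>w\<^bsub>N+1\<^esub> = w\<^sub>1\<close>.
\<close>

definition vertex :: "complex list \<Rightarrow> nat \<Rightarrow> complex" where
  "vertex ws j = ws ! (j mod length ws)"

text \<open>The edge with index \<open>j \<ge> 1\<close> joins vertex \<open>j - 1\<close> to vertex \<open>j\<close>.\<close>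

definition edge_length :: "complex list \<Rightarrow> nat \<Rightarrow> real" where
  "edge_length ws j = norm (vertex ws j - vertex ws (j - 1))"

definition edge_tangent :: "complex list \<Rightarrow> nat \<Rightarrow> complex" where
  "edge_tangent ws j = (vertex ws j - vertex ws (j - 1)) / complex_of_real (edge_length ws j)"

text \<open>
  The unit normal \<open>n\<close> with \<open>det (n, t) = 1\<close> is the tangent \<open>t\<close> rotated clockwise by a right angle;
  it points outwards because polygons are numbered counterclockwise.
\<close>

definition edge_normal :: "complex list \<Rightarrow> nat \<Rightarrow> complex" where
  "edge_normal ws j = - \<i> * edge_tangent ws j"

definition outer_angle :: "complex list \<Rightarrow> nat \<Rightarrow> real" where
  "outer_angle ws j = Arg (edge_tangent ws (Suc j) / edge_tangent ws j)"

definition height :: "complex list \<Rightarrow> nat \<Rightarrow> real" where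
  "height ws j = vertex ws j \<bullet> edge_normal ws j"

fun polyline :: "complex list \<Rightarrow> real \<Rightarrow> complex" where
  "polyline [] = linepath 0 0"
| "polyline [a] = linepath a a"
| "polyline [a, b] = linepath a b"
| "polyline (a # b # c # ws) = linepath a b +++ polyline (b # c # ws)"

definition polygon_path :: "complex list \<Rightarrow> real \<Rightarrow> complex" where
  "polygon_path ws = polyline (ws @ [hd ws])"

definition is_polygon :: "complex list \<Rightarrow> bool" where
  "is_polygon ws \<longleftrightarrow>
     3 \<le> length ws \<and>
     simple_path (polygon_path ws) \<and>
     (\<forall>z \<in> inside (path_image (polygon_path ws)). winding_number (polygon_path ws) z = 1) \<and>
     (\<forall>j \<in> {1..length ws}. outer_angle ws j \<in> {-pi<..<pi} - {0})"

text \<open>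
  The equivalence class of the numbered polygon \<open>P\<close>. Each member is represented by its vertices,
  numbered so that its normals agree with those of \<open>P\<close> index by index.
\<close>

definition poly_class :: "complex list \<Rightarrow> complex list set" where
  "poly_class P = {ws. is_polygon ws \<and> length ws = length P \<and>
     (\<forall>j \<in> {1..length P}. edge_normal ws j = edge_normal P j)}"

definition poly_dist :: "nat \<Rightarrow> complex list \<Rightarrow> complex list \<Rightarrow> real" where
  "poly_dist N \<Gamma> \<Sigma> = Max ((\<lambda>j. \<bar>height \<Gamma> j - height \<Sigma> j\<bar>) ` {1..N})"

definition poly_topology :: "complex list \<Rightarrow> complex list topology" where
  "poly_topology P = Metric_space.mtopology (poly_class P) (poly_dist (length P))"

text \<open>\<open>poly_topology\<close> is meaningful because \<open>poly_dist\<close> is a metric on the class.\<close>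

lemma inner_edge_normal:
  "(vertex ws j - vertex ws (j - 1)) \<bullet> edge_normal ws j = 0"
  by (simp add: edge_normal_def edge_tangent_def inner_complex_def Re_divide_of_real Im_divide_of_real
      algebra_simps diff_divide_distrib)

lemma independent_normals:
  assumes "Arg (b / a) \<notin> {0, pi}" "x \<bullet> (- \<i> * a) = 0" "x \<bullet> (- \<i> * b) = 0"
  shows "x = 0"
proof -
  have "b / a \<notin> \<real>"
    using assms(1) Arg_eq_0_pi complex_is_Real_iff Arg_zero by (metis insertCI insertE singletonD)
  then have ab: "a \<noteq> 0" "b \<noteq> 0" by auto
  have "Im b * Re a - Re b * Im a \<noteq> 0"
    using \<open>b / a \<notin> \<real>\<close> ab by (auto simp: complex_is_Real_iff Im_divide)
  moreover have "Re x * Im a = Im x * Re a" "Re x * Im b = Im x * Re b"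
    using assms(2,3) by (auto simp: inner_complex_def)
  then have "Re x * (Im b * Re a - Re b * Im a) = 0" "Im x * (Im b * Re a - Re b * Im a) = 0"
    by algebra+
  ultimately show ?thesis by (simp add: complex_eq_iff)
qed

lemma heights_determine_polygon:
  assumes "\<Gamma> \<in> poly_class P" "\<Sigma> \<in> poly_class P"
    and "\<And>j. j \<in> {1..length P} \<Longrightarrow> height \<Gamma> j = height \<Sigma> j"
  shows "\<Gamma> = \<Sigma>"
proof -
  define N where "N = length P"
  have len: "length \<Gamma> = N" "length \<Sigma> = N" "3 \<le> N"
    using assms(1,2) by (auto simp: poly_class_def is_polygon_def N_def)
  have wrap: "vertex ws (Suc N) = vertex ws 1 \<and> vertex ws N = vertex ws 0"
    if "length ws = N" for ws
    using that len(3) by (simp add: vertex_def mod_Suc)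
  have nrm: "edge_normal \<Gamma> j = edge_normal \<Sigma> j" "height \<Gamma> j = height \<Sigma> j"
    if "j \<in> {1..Suc N}" for j
  proof -
    have wrapn: "edge_normal ws (Suc N) = edge_normal ws 1 \<and> height ws (Suc N) = height ws 1"
      if "length ws = N" for ws
      using wrap[OF that] by (simp add: edge_normal_def edge_tangent_def edge_length_def height_def)
    have "edge_normal \<Gamma> j = edge_normal \<Sigma> j \<and> height \<Gamma> j = height \<Sigma> j" if "j \<in> {1..N}" for j
      using that assms by (auto simp: poly_class_def N_def)
    then show "edge_normal \<Gamma> j = edge_normal \<Sigma> j" "height \<Gamma> j = height \<Sigma> j"
      using that wrapn len by (cases "j = Suc N"; force)+
  qed
  have eq: "vertex \<Gamma> j = vertex \<Sigma> j" if j: "j \<in> {1..N}" for j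
  proof -
    let ?x = "vertex \<Gamma> j - vertex \<Sigma> j"
    have "?x \<bullet> edge_normal \<Gamma> j = 0"
      using nrm[of j] j by (simp add: height_def inner_diff_left)
    moreover have "?x \<bullet> edge_normal \<Gamma> (Suc j) = 0"
      using nrm[of "Suc j"] j inner_edge_normal[of \<Gamma> "Suc j"] inner_edge_normal[of \<Sigma> "Suc j"]
      by (simp add: height_def inner_diff_left)
    moreover have "outer_angle \<Gamma> j \<notin> {0, pi}"
      using assms(1) j len by (force simp: poly_class_def is_polygon_def)
    ultimately have "?x = 0"
      using independent_normals unfolding edge_normal_def outer_angle_def by blast
    then show ?thesis by simp
  qed
  show ?thesis
  proof (rule nth_equalityI)
    fix i assume "i < length \<Gamma>"
    then have i: "i < N" using len by simp
    then show "\<Gamma> ! i = \<Sigma> ! i"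
      using eq[of i] eq[of N] len by (cases "i = 0") (auto simp: vertex_def)
  qed (use len in simp)
qed

lemma Metric_space_poly_class:
  assumes "is_polygon P"
  shows "Metric_space (poly_class P) (poly_dist (length P))"
proof -
  let ?N = "length P"
  have ne: "{1..?N} \<noteq> {}" using assms by (auto simp: is_polygon_def)
  have upper: "\<bar>height \<Gamma> j - height \<Sigma> j\<bar> \<le> poly_dist ?N \<Gamma> \<Sigma>" if "j \<in> {1..?N}" for \<Gamma> \<Sigma> j
    unfolding poly_dist_def using that by (intro Max_ge) auto
  have least: "poly_dist ?N \<Gamma> \<Sigma> \<le> B"
    if "\<And>j. j \<in> {1..?N} \<Longrightarrow> \<bar>height \<Gamma> j - height \<Sigma> j\<bar> \<le> B" for \<Gamma> \<Sigma> B
    unfolding poly_dist_def using that ne by (subst Max_le_iff) auto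
  have nonneg: "0 \<le> poly_dist ?N \<Gamma> \<Sigma>" for \<Gamma> \<Sigma>
    using ne upper[of _ \<Gamma> \<Sigma>] by (meson abs_ge_zero ex_in_conv order_trans)
  show ?thesis
  proof
    show "poly_dist ?N x y = poly_dist ?N y x" for x y
      by (simp add: poly_dist_def abs_minus_commute)
    show "poly_dist ?N x y = 0 \<longleftrightarrow> x = y" if "x \<in> poly_class P" "y \<in> poly_class P" for x y
    proof
      assume "poly_dist ?N x y = 0"
      then show "x = y"
        using upper[of _ x y] that by (intro heights_determine_polygon[of x P y]) force+
    next
      assume "x = y"
      then show "poly_dist ?N x y = 0"
        using least[of x y 0] nonneg[of x y] by force
    qed
    show "poly_dist ?N x z \<le> poly_dist ?N x y + poly_dist ?N y z" for x y z
    proof (rule least)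
      fix j assume "j \<in> {1..?N}"
      then show "\<bar>height x j - height z j\<bar> \<le> poly_dist ?N x y + poly_dist ?N y z"
        using upper[of j x y] upper[of j y z] by linarith
    qed
  qed (rule nonneg)
qed

text \<open>Derivatives at the end points of an interval are one-sided.\<close>

definition Ck_on :: "nat \<Rightarrow> real set \<Rightarrow> (real \<Rightarrow> 'a::real_normed_vector) \<Rightarrow> bool" where
  "Ck_on k S f \<longleftrightarrow>
     (\<exists>D. D 0 = f \<and>
          (\<forall>i<k. \<forall>t\<in>S. (D i has_vector_derivative D (Suc i) t) (at t within S)) \<and>
          (\<forall>i\<le>k. continuous_on S (D i)))"

definition polygonal_motion ::
    "complex list \<Rightarrow> nat \<Rightarrow> real set \<Rightarrow> (real \<Rightarrow> complex list) \<Rightarrow> bool" where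
  "polygonal_motion P k S \<Gamma> \<longleftrightarrow>
     (\<forall>t\<in>S. \<Gamma> t \<in> poly_class P) \<and>
     (\<forall>j \<in> {1..length P}. Ck_on k S (\<lambda>t. vertex (\<Gamma> t) j))"

text \<open>
  The normal velocity of the \<open>j\<close>th edge is constant along the edge and equals the time derivative of
  the \<open>j\<close>th height.
\<close>

definition normal_velocity ::
    "real set \<Rightarrow> (real \<Rightarrow> complex list) \<Rightarrow> nat \<Rightarrow> real \<Rightarrow> real" where
  "normal_velocity S \<Gamma> j t = vector_derivative (\<lambda>s. height (\<Gamma> s) j) (at t within S)"

text \<open>
  A vector field \<open>F : U \<times> [0, T\<^sub>*) \<rightarrow> \<real>\<^sup>N\<close> is given by its components \<open>F \<Gamma> t j\<close>, \<open>1 \<le> j \<le> N\<close>;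
  only its values on \<open>U \<times> [0, T\<^sub>*)\<close> matter.
\<close>

definition continuous_field ::
    "complex list \<Rightarrow> complex list set \<Rightarrow> ereal \<Rightarrow> (complex list \<Rightarrow> real \<Rightarrow> nat \<Rightarrow> real) \<Rightarrow> bool" where
  "continuous_field P U Tstar F \<longleftrightarrow>
     (\<forall>j \<in> {1..length P}.
        continuous_map
          (prod_topology (subtopology (poly_topology P) U)
                         (top_of_set {t. 0 \<le> t \<and> ereal t < Tstar}))
          euclideanreal (\<lambda>(\<Gamma>, t). F \<Gamma> t j))"

definition locally_lipschitz_field ::
    "complex list \<Rightarrow> complex list set \<Rightarrow> ereal \<Rightarrow> (complex list \<Rightarrow> real \<Rightarrow> nat \<Rightarrow> real) \<Rightarrow> bool" where
  "locally_lipschitz_field P U Tstar F \<longleftrightarrow>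
     (\<forall>K T'. compactin (poly_topology P) K \<and> K \<subseteq> U \<and> 0 < T' \<and> ereal T' < Tstar \<longrightarrow>
        (\<exists>L>0. \<forall>\<Gamma>\<in>K. \<forall>\<Sigma>\<in>K. \<forall>t\<in>{0..T'}.
           Max ((\<lambda>j. \<bar>F \<Gamma> t j - F \<Sigma> t j\<bar>) ` {1..length P}) \<le> L * poly_dist (length P) \<Gamma> \<Sigma>))"

text \<open>\<open>M\<close> is the polygon \<open>(\<Gamma> + \<Sigma>) / 2\<close> in the class of \<open>P\<close>; it need not exist.\<close>

definition is_midpoint ::
    "complex list \<Rightarrow> complex list \<Rightarrow> complex list \<Rightarrow> complex list \<Rightarrow> bool" where
  "is_midpoint P \<Gamma> \<Sigma> M \<longleftrightarrow>
     M \<in> poly_class P \<and> (\<forall>j \<in> {1..length P}. height M j = (height \<Gamma> j + height \<Sigma> j) / 2)"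

text \<open>One step of the implicit scheme from \<open>\<Gamma>\<close> at time \<open>s\<close> to \<open>\<Sigma>\<close> at time \<open>s'\<close>.\<close>

definition scheme_step ::
    "complex list \<Rightarrow> complex list set \<Rightarrow> (complex list \<Rightarrow> real \<Rightarrow> nat \<Rightarrow> real) \<Rightarrow>
     real \<Rightarrow> real \<Rightarrow> complex list \<Rightarrow> complex list \<Rightarrow> bool" where
  "scheme_step P U F s s' \<Gamma> \<Sigma> \<longleftrightarrow>
     (\<exists>M\<in>U. is_midpoint P \<Gamma> \<Sigma> M \<and>
        (\<forall>j \<in> {1..length P}. (height \<Sigma> j - height \<Gamma> j) / (s' - s) = F M ((s + s') / 2) j))"

end

theory Submission
  imports Defs
begin

text \<open>
  In the coordinates \<open>h = (h\<^sub>1, \<dots>, h\<^sub>N)\<close> the motion is an ordinary differential equation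
  \<open>h' = F(h, t)\<close>, and the scheme is the implicit midpoint rule for it. The classical convergence
  proof therefore applies, provided that the equivalence class of polygons can be treated as an open
  subset of \<open>\<real>\<^sup>N\<close>. This is the geometric part of the proof.

  Geometry. The vertex \<open>w\<^sub>j\<close> solves the two linear equations
  \<open>w\<^sub>j \<bullet> n\<^sub>j = h\<^sub>j\<close>, \<open>w\<^sub>j \<bullet> n\<^bsub>j+1\<^esub> = h\<^bsub>j+1\<^esub>\<close>,
  which are independent since the outer angle at \<open>w\<^sub>j\<close> is neither \<open>0\<close> nor \<open>\<plusminus>\<pi>\<close>. Small changes of
  the heights thus move the vertices a little and keep the directions of the edges, hence also the
  outer angles. The perturbed closed polyline is still simple, because edges without a common vertex
  have positive distance and edges with a common vertex are not parallel. It still runs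
  counterclockwise, because it is homotopic to the old one in the complement of a point that the
  old one winds around once. So every height vector near that of a member of the class belongs to a
  member of the class (\<open>heights_realizable\<close>). By compactness of the time interval the same
  holds, with one radius \<open>r\<close>, along the whole motion, and the polygons obtained lie in one compact set
  (\<open>compact_tube\<close>), on which \<open>F\<close> has a Lipschitz constant \<open>L\<close>.

  One step. A step from \<open>G\<close> of size \<open>\<tau>\<close> is determined by its midpoint \<open>M\<close>, a fixed point of
  \<open>h(M) = h(G) + (\<tau>/2) F(M)\<close>. For small \<open>\<tau>\<close> the right-hand side is a contraction of a small
  closed ball around \<open>G\<close>, so the step exists and is unique among small ones
  (\<open>unique_implicit_step\<close>).

  Error. Since \<open>F(\<Gamma>(t), t) = h'(t)\<close>, inserting the exact heights into one step leaves two defects: that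
  of the midpoint quadrature rule for \<open>h'\<close>, and the difference between \<open>h\<close> at the middle time and
  the mean of \<open>h\<close> at the two ends. Both are symmetric differences, which accounts for the orders
  \<open>o(1)\<close>, \<open>o(\<tau>)\<close>, \<open>O(\<tau>\<^sup>2)\<close> for one, two and three continuous derivatives
  (\<open>truncation_error\<close>). With a bound \<open>\<eta>(\<tau>)\<close> for both defects (for the first one per unit of time), the distance
  \<open>e\<^sub>m\<close> between the exact and the computed polygon at the time \<open>t\<^sub>m\<close> satisfies
  \<open>e\<^bsub>m+1\<^esub> \<le> e\<^sub>m + \<tau>\<^sub>m (L (e\<^sub>m + e\<^bsub>m+1\<^esub>)/2 + (L + 1) \<eta>(\<tau>))\<close>, and a discrete Gronwall
  argument gives \<open>e\<^sub>m \<le> exp (2 L T) (e\<^sub>0 + T (L + 1) \<eta>(\<tau>))\<close>. If \<open>\<tau>\<close> and \<open>e\<^sub>0\<close> are small, this bound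
  is below \<open>r/4\<close>; so the polygons never leave the tube and the construction can go on
  (\<open>implicit_scheme_converges\<close>).
\<close>

section \<open>Simple closed polylines\<close>

lemma polyline_image:
  "2 \<le> length xs \<Longrightarrow> path (polyline xs) \<and> pathstart (polyline xs) = hd xs \<and> pathfinish (polyline xs) = last xs \<and>
    path_image (polyline xs) = (\<Union>i<length xs - 1. closed_segment (xs ! i) (xs ! Suc i))"
proof (induction xs rule: polyline.induct)
  case (4 a b c ws)
  have "(\<Union>i<length (a # b # c # ws) - 1. closed_segment ((a # b # c # ws) ! i) ((a # b # c # ws) ! Suc i))
    = closed_segment a b \<union> (\<Union>i<length (b # c # ws) - 1. closed_segment ((b # c # ws) ! i) ((b # c # ws) ! Suc i))"
    by (simp add: lessThan_Suc_eq_insert_0)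
  with 4 show ?case by (simp add: path_image_join)
qed (auto simp: lessThan_Suc)

text \<open>
  A polyline grows at its front by one segment, which may meet the rest only at the point where it
  is attached. This recursion asks of two segments, adjacent or not, only that they do not meet away
  from the end of the first one; \<open>nonadjacent_edges_disjoint\<close> sharpens this.
\<close>

lemma arc_polyline_iff:
  "2 \<le> length xs \<Longrightarrow> arc (polyline xs) \<longleftrightarrow>
     (\<forall>i<length xs - 1. xs ! i \<noteq> xs ! Suc i) \<and>
     (\<forall>j<length xs - 1. \<forall>i<j. closed_segment (xs ! i) (xs ! Suc i) \<inter> closed_segment (xs ! j) (xs ! Suc j) \<subseteq> {xs ! Suc i})"
proof (induction xs rule: polyline.induct)
  case (3 a b)
  then show ?case by (auto simp: arc_simple_path)
next
  case (4 a b c ws)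
  let ?r = "b # c # ws"
  have length_r: "2 \<le> length ?r" by simp
  have "arc (polyline (a # ?r)) \<longleftrightarrow> a \<noteq> b \<and> arc (polyline ?r) \<and>
     closed_segment a b \<inter> path_image (polyline ?r) \<subseteq> {b}"
  proof -
    have "pathstart (polyline ?r) = b" using polyline_image[of ?r] by simp
    moreover have "arc (linepath a b) \<longleftrightarrow> a \<noteq> b" by (auto simp: arc_simple_path)
    ultimately show ?thesis
      unfolding polyline.simps(4)[of a b c ws] by (subst arc_join_eq) (simp_all del: polyline.simps)
  qed
  also have "closed_segment a b \<inter> path_image (polyline ?r) \<subseteq> {b} \<longleftrightarrow>
     (\<forall>j<length ?r - 1. closed_segment a b \<inter> closed_segment (?r ! j) (?r ! Suc j) \<subseteq> {b})"
    using polyline_image[of ?r] by auto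
  finally have "arc (polyline (a # ?r)) \<longleftrightarrow> a \<noteq> b \<and> arc (polyline ?r) \<and>
     (\<forall>j<length ?r - 1. closed_segment a b \<inter> closed_segment (?r ! j) (?r ! Suc j) \<subseteq> {b})" .
  moreover have "length (a # ?r) - 1 = Suc (length ?r - 1)" by simp
  ultimately show ?case
    unfolding 4(1)[OF length_r] by (simp only: All_less_Suc2 nth_Cons_Suc nth_Cons_0) blast
qed auto

lemma linepath_close:
  fixes a b a' b' :: complex
  assumes "dist a a' < e" "dist b b' < e" "x \<in> {0..1}"
  shows "dist (linepath a b x) (linepath a' b' x) < e"
proof -
  have "linepath a b x - linepath a' b' x = (1 - x) *\<^sub>R (a - a') + x *\<^sub>R (b - b')"
    by (simp add: linepath_def algebra_simps)
  moreover have "\<dots> \<in> ball 0 e"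
    using assms by (intro convexD[OF convex_ball]) (auto simp: dist_norm norm_minus_commute)
  ultimately show ?thesis
    by (metis dist_norm mem_ball_0)
qed

lemma closed_segment_close:
  fixes a b a' b' :: complex
  assumes "dist a a' < e" "dist b b' < e" "y \<in> closed_segment a' b'"
  shows "\<exists>x \<in> closed_segment a b. dist x y < e"
proof -
  obtain x where "x \<in> {0..1}" "y = linepath a' b' x"
    using assms(3) linepath_image_01 by blast
  then show ?thesis
    using linepath_close[OF assms(1,2), of x] linepath_image_01 by blast
qed

text \<open>
  The parameter interval of a polyline is divided according to the number of its segments and not to
  their lengths. Polylines with equally many vertices can therefore be compared parameter by
  parameter, and the distance is controlled by that of the vertices.
\<close>

lemma polyline_close:
  assumes "length xs = length ys" "2 \<le> length xs"
    and "\<And>i. i < length xs \<Longrightarrow> dist (xs ! i) (ys ! i) < e" and "x \<in> {0..1}"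
  shows "dist (polyline xs x) (polyline ys x) < e"
  using assms
proof (induction xs arbitrary: ys x rule: polyline.induct)
  case (3 a b)
  then have "length ys = Suc (Suc 0)" by simp
  then obtain a' b' where "ys = [a',b']"
    by (auto simp: length_Suc_conv)
  with 3(3)[of 0] 3(3)[of 1] 3(4) show ?case by (simp add: linepath_close)
next
  case (4 a b c ws)
  then have "length ys = Suc (Suc (Suc (length ws)))" by simp
  then obtain a' b' c' ws' where ys: "ys = a' # b' # c' # ws'"
    by (auto simp: length_Suc_conv)
  have 0: "dist a a' < e" "dist b b' < e" using 4(4)[of 0] 4(4)[of 1] ys by auto
  have *: "dist ((b # c # ws) ! i) ((b' # c' # ws') ! i) < e" if "i < length (b # c # ws)" for i
    using 4(4)[of "Suc i"] that ys by auto
  have "dist (polyline (b # c # ws) y) (polyline (b' # c' # ws') y) < e" if "y \<in> {0..1}" for y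
    using 4(1)[of "b' # c' # ws'" y] * that 4(2) ys by auto
  with 0 show ?case using 4(5) ys by (auto simp: joinpaths_def linepath_close simp del: polyline.simps(3))
qed auto

text \<open>Segments are counted from \<open>0\<close>, like the positions in the list: segment \<open>i\<close> is the edge with index
  \<open>i + 1\<close>.\<close>

definition edge_segment :: "complex list \<Rightarrow> nat \<Rightarrow> complex set" where
  "edge_segment ws i = closed_segment (vertex ws i) (vertex ws (Suc i))"

text \<open>
  The first edge is attached at both of its ends; the remaining edges form an arc, to which
  \<open>arc_polyline_iff\<close> applies.
\<close>

lemma simple_polygon_path_iff:
  assumes "3 \<le> length ws"
  shows "simple_path (polygon_path ws) \<longleftrightarrow>
    (\<forall>i<length ws. vertex ws i \<noteq> vertex ws (Suc i)) \<and>
    (\<forall>j<length ws. \<forall>i<j. 1 \<le> i \<longrightarrow> edge_segment ws i \<inter> edge_segment ws j \<subseteq> {vertex ws (Suc i)}) \<and>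
    (\<forall>j<length ws. 1 \<le> j \<longrightarrow> edge_segment ws 0 \<inter> edge_segment ws j \<subseteq> {vertex ws 0, vertex ws 1})"
proof -
  obtain a b c r where ws: "ws = a # b # c # r"
    using assms by (auto simp: numeral_3_eq_3 Suc_le_length_iff)
  define ys where "ys = b # c # r @ [a]"
  define M where "M = length ys - 1"
  have ly: "2 \<le> length ys" and lw: "length ws = Suc M" by (auto simp: ys_def ws M_def)
  have nth: "ys ! i = vertex ws (Suc i)" if "i \<le> M" for i
    using that by (auto simp: ys_def ws vertex_def nth_Cons nth_append M_def mod_Suc split: nat.splits)
  have v: "vertex ws 0 = a" "vertex ws (Suc 0) = b" by (auto simp: ws vertex_def)
  have seg: "closed_segment (ys ! i) (ys ! Suc i) = edge_segment ws (Suc i)" if "i < M" for i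
    using that nth[of i] nth[of "Suc i"] by (simp add: edge_segment_def)
  have pp: "polygon_path ws = linepath a b +++ polyline ys"
    by (simp add: polygon_path_def ws ys_def)
  have im: "path_image (polyline ys) = (\<Union>i<M. edge_segment ws (Suc i))"
    using polyline_image[OF ly] seg by (simp add: M_def)
  have ends: "pathstart (polyline ys) = b" "pathfinish (polyline ys) = a"
    using polyline_image[OF ly] by (auto simp: ys_def)
  have seg': "closed_segment (vertex ws (Suc i)) (vertex ws (Suc (Suc i))) = edge_segment ws (Suc i)" for i
    by (simp add: edge_segment_def)
  have arc: "arc (polyline ys) \<longleftrightarrow> (\<forall>i<M. vertex ws (Suc i) \<noteq> vertex ws (Suc (Suc i))) \<and>
      (\<forall>j<M. \<forall>i<j. edge_segment ws (Suc i) \<inter> edge_segment ws (Suc j) \<subseteq> {vertex ws (Suc (Suc i))})"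
    unfolding arc_polyline_iff[OF ly] M_def[symmetric]
    by (simp add: nth seg seg')
  have "simple_path (polygon_path ws) \<longleftrightarrow> a \<noteq> b \<and> arc (polyline ys) \<and>
     edge_segment ws 0 \<inter> (\<Union>i<M. edge_segment ws (Suc i)) \<subseteq> {a, b}"
    unfolding pp using ends im by (subst simple_path_join_loop_eq) (auto simp: arc_simple_path edge_segment_def v)
  also have "\<dots> \<longleftrightarrow> (a \<noteq> b \<and> (\<forall>i<M. vertex ws (Suc i) \<noteq> vertex ws (Suc (Suc i)))) \<and>
      (\<forall>j<M. \<forall>i<j. edge_segment ws (Suc i) \<inter> edge_segment ws (Suc j) \<subseteq> {vertex ws (Suc (Suc i))}) \<and>
      (\<forall>j<M. edge_segment ws 0 \<inter> edge_segment ws (Suc j) \<subseteq> {a, b})"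
    unfolding arc by blast
  also have "(\<forall>j<M. \<forall>i<j. edge_segment ws (Suc i) \<inter> edge_segment ws (Suc j) \<subseteq> {vertex ws (Suc (Suc i))}) \<longleftrightarrow>
     (\<forall>j<Suc M. \<forall>i<j. 1 \<le> i \<longrightarrow> edge_segment ws i \<inter> edge_segment ws j \<subseteq> {vertex ws (Suc i)})"
    by (simp add: All_less_Suc2)
  also have "(\<forall>j<M. edge_segment ws 0 \<inter> edge_segment ws (Suc j) \<subseteq> {a, b}) \<longleftrightarrow>
     (\<forall>j<Suc M. 1 \<le> j \<longrightarrow> edge_segment ws 0 \<inter> edge_segment ws j \<subseteq> {a, b})"
    by (simp add: All_less_Suc2)
  also have "(a \<noteq> b \<and> (\<forall>i<M. vertex ws (Suc i) \<noteq> vertex ws (Suc (Suc i)))) \<longleftrightarrow>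
    (\<forall>i<Suc M. vertex ws i \<noteq> vertex ws (Suc i))"
    by (simp add: All_less_Suc2 v)
  finally show ?thesis by (simp add: lw v)
qed

lemma vertex_wrap:
  assumes "3 \<le> length ws"
  shows "vertex ws (length ws) = vertex ws 0" "vertex ws (Suc (length ws)) = vertex ws 1"
    "edge_segment ws (length ws) = edge_segment ws 0"
    "edge_tangent ws (Suc (length ws)) = edge_tangent ws 1"
proof -
  show *: "vertex ws (length ws) = vertex ws 0" "vertex ws (Suc (length ws)) = vertex ws 1"
    using assms by (auto simp: vertex_def mod_Suc)
  then show "edge_segment ws (length ws) = edge_segment ws 0"
    "edge_tangent ws (Suc (length ws)) = edge_tangent ws 1"
    by (auto simp: edge_segment_def edge_tangent_def edge_length_def)
qed

text \<open>
  If the end of an edge lay on a later edge not adjacent to it, it would be common to that edge and the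
  edge that starts there, and so would coincide with the next vertex. The first edge needs extra care, since it may
  meet other edges at either end: its initial vertex is also the end of the last edge.
\<close>

lemma nonadjacent_edges_disjoint:
  assumes "3 \<le> length ws" "simple_path (polygon_path ws)"
    and "i + 2 \<le> j" "j < length ws" "i = 0 \<longrightarrow> Suc j < length ws"
  shows "edge_segment ws i \<inter> edge_segment ws j = {}"
proof -
  define N where "N = length ws"
  have ne: "vertex ws i \<noteq> vertex ws (Suc i)" if "i < N" for i
    using assms(1,2) that by (auto simp: simple_polygon_path_iff N_def)
  have int: "edge_segment ws i \<inter> edge_segment ws j \<subseteq> {vertex ws (Suc i)}" if "1 \<le> i" "i < j" "j < N" for i j
    using assms(1,2) that by (auto simp: simple_polygon_path_iff N_def)
  have int0: "edge_segment ws 0 \<inter> edge_segment ws j \<subseteq> {vertex ws 0, vertex ws 1}" if "1 \<le> j" "j < N" for j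
    using assms(1,2) that by (auto simp: simple_polygon_path_iff N_def)
  have ends: "vertex ws i \<in> edge_segment ws i" "vertex ws (Suc i) \<in> edge_segment ws i" for i
    by (auto simp: edge_segment_def)
  have next_notin: "vertex ws (Suc i) \<notin> edge_segment ws j" if "i + 2 \<le> j" "j < N" for i j
  proof
    assume "vertex ws (Suc i) \<in> edge_segment ws j"
    then have "vertex ws (Suc i) \<in> {vertex ws (Suc (Suc i))}"
      using int[of "Suc i" j] ends(1)[of "Suc i"] that by auto
    then show False using ne[of "Suc i"] that by auto
  qed
  have first_notin: "vertex ws 0 \<notin> edge_segment ws j" if j: "2 \<le> j" "Suc j < N" for j
  proof
    assume "vertex ws 0 \<in> edge_segment ws j"
    moreover have "j < N - 1" using j by linarith
    moreover have v0: "vertex ws 0 = vertex ws (Suc (N - 1))"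
      using vertex_wrap(1)[OF assms(1)] assms(1) unfolding N_def by (metis Suc_diff_1 not_numeral_le_zero gr0I)
    ultimately have "vertex ws 0 \<in> {vertex ws (Suc j)}"
      using int[of j "N - 1"] j ends(2)[of "N - 1"] by auto
    then have eq: "vertex ws (Suc j) = vertex ws (Suc (N - 1))" using v0 by auto
    show False
    proof (cases "Suc j = N - 1")
      case True
      then show False using ne[of "Suc j"] eq j by auto
    next
      case False
      then show False using next_notin[of j "N - 1"] eq ends(2)[of "N - 1"] j by auto
    qed
  qed
  show ?thesis
  proof (cases "i = 0")
    case True
    then show ?thesis
      using int0[of j] first_notin[of j] next_notin[of 0 j] assms(3-5) by (auto simp: N_def)
  next
    case False
    then show ?thesis
      using int[of i j] next_notin[of i j] assms(3-5) by (auto simp: N_def)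
  qed
qed

lemma simple_polygon_pathI:
  assumes "3 \<le> length ws"
    and "\<And>i. i < length ws \<Longrightarrow> vertex ws i \<noteq> vertex ws (Suc i)"
    and adj: "\<And>i. i < length ws \<Longrightarrow> edge_segment ws i \<inter> edge_segment ws (Suc i) \<subseteq> {vertex ws (Suc i)}"
    and nonadj: "\<And>i j. \<lbrakk>i + 2 \<le> j; j < length ws; i = 0 \<longrightarrow> Suc j < length ws\<rbrakk> \<Longrightarrow> edge_segment ws i \<inter> edge_segment ws j = {}"
  shows "simple_path (polygon_path ws)"
  unfolding simple_polygon_path_iff[OF assms(1)]
proof (intro conjI allI impI)
  fix i j assume "j < length ws" "i < j" "1 \<le> i"
  then show "edge_segment ws i \<inter> edge_segment ws j \<subseteq> {vertex ws (Suc i)}"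
    using adj[of i] nonadj[of i j] by (cases "j = Suc i") auto
next
  fix j assume j: "j < length ws" "1 \<le> j"
  consider "j = 1" | "Suc j = length ws" | "2 \<le> j" "Suc j < length ws" using j by linarith
  then show "edge_segment ws 0 \<inter> edge_segment ws j \<subseteq> {vertex ws 0, vertex ws 1}"
  proof cases
    case 1
    then show ?thesis using adj[of 0] j by fastforce
  next
    case 2
    then show ?thesis using adj[of j] j vertex_wrap[OF assms(1)] by auto
  next
    case 3
    then show ?thesis using nonadj[of 0 j] by auto
  qed
qed (use assms in auto)

text \<open>The determinant of the pair of plane vectors.\<close>

definition cross :: "complex \<Rightarrow> complex \<Rightarrow> real" where
  "cross a b = Im (cnj a * b)"

text \<open>
  A common point other than \<open>b\<close> would make the two segments parallel.
\<close>

lemma adjacent_segments: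
  assumes "cross (b - a) (c - b) \<noteq> 0"
  shows "closed_segment a b \<inter> closed_segment b c \<subseteq> {b}"
proof
  fix x assume "x \<in> closed_segment a b \<inter> closed_segment b c"
  then obtain s r where s: "x = (1 - s) *\<^sub>R a + s *\<^sub>R b" and r: "x = (1 - r) *\<^sub>R b + r *\<^sub>R c"
    unfolding Int_iff in_segment by blast
  have x: "b - x = (1 - s) *\<^sub>R (b - a)"
    unfolding s by (simp add: algebra_simps)
  have x': "x - b = r *\<^sub>R (c - b)"
    unfolding r by (simp add: algebra_simps)
  have "r *\<^sub>R (c - b) = - ((1 - s) *\<^sub>R (b - a))"
    using x x' by (metis minus_diff_eq)
  then have "cross (b - a) (r *\<^sub>R (c - b)) = cross (b - a) (- ((1 - s) *\<^sub>R (b - a)))"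
    by simp
  then have "r * cross (b - a) (c - b) = 0"
    by (simp add: cross_def algebra_simps)
  then show "x \<in> {b}" using x' assms by simp
qed

text \<open>
  Tangents are parallel exactly if the outer angle between them is \<open>0\<close> or \<open>\<pi>\<close>.
\<close>

lemma is_polygon_cross:
  assumes "is_polygon ws" "j \<in> {1..length ws}"
  shows "cross (edge_tangent ws j) (edge_tangent ws (Suc j)) \<noteq> 0"
proof
  let ?a = "edge_tangent ws j" and ?b = "edge_tangent ws (Suc j)"
  assume 0: "cross ?a ?b = 0"
  have "?b / ?a = (cnj ?a * ?b) / (norm ?a)\<^sup>2"
    by (subst complex_div_cnj) (simp add: mult.commute)
  moreover have "\<dots> \<in> \<real>"
    using 0 unfolding cross_def complex_is_Real_iff by simp
  ultimately have "?b / ?a \<in> \<real>" by simp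
  then have "Arg (?b / ?a) \<in> {0, pi}" by (simp add: Arg_eq_0_pi)
  moreover have "Arg (?b / ?a) \<in> {-pi<..<pi} - {0}"
    using assms by (auto simp: is_polygon_def outer_angle_def)
  ultimately show False by auto
qed

lemma edge_vector:
  assumes "vertex ws j \<noteq> vertex ws (j - 1)"
  shows "vertex ws j - vertex ws (j - 1) = edge_length ws j *\<^sub>R edge_tangent ws j" "edge_length ws j > 0"
    "norm (edge_tangent ws j) = 1"
  using assms by (auto simp: edge_tangent_def edge_length_def scaleR_conv_of_real norm_divide)

section \<open>Stability of polygons\<close>

lemma cross_scaleR: "cross (a *\<^sub>R x) (b *\<^sub>R y) = a * b * cross x y"
  by (simp add: cross_def algebra_simps)

text \<open>
  Disjoint segments have a positive distance \<open>r\<close>. If their end points move by less than \<open>r/2\<close>, so does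
  every point of them, and they stay disjoint. Validity for all small \<open>e\<close> is expressed by a
  filter, so that finitely many such statements can be combined.
\<close>

lemma compact_separation_stable:
  fixes a b c d :: complex
  assumes "closed_segment a b \<inter> closed_segment c d = {}"
  shows "\<forall>\<^sub>F e in at_right 0. \<forall>a' b' c' d'. dist a a' < e \<and> dist b b' < e \<and> dist c c' < e \<and> dist d d' < e \<longrightarrow>
     closed_segment a' b' \<inter> closed_segment c' d' = {}"
proof -
  obtain r where "r > 0" and r: "\<And>x y. x \<in> closed_segment a b \<Longrightarrow> y \<in> closed_segment c d \<Longrightarrow> r \<le> dist x y"
    using separate_compact_closed[OF compact_segment closed_segment assms] by blast
  have "\<forall>\<^sub>F e in at_right 0. e < r / 2"
    using \<open>r > 0\<close> by (intro eventually_at_rightI[of 0 "r / 2"]) auto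
  then show ?thesis
  proof eventually_elim
    case (elim e)
    have False if close: "dist a a' < e" "dist b b' < e" "dist c c' < e" "dist d d' < e"
      and z: "z \<in> closed_segment a' b'" "z \<in> closed_segment c' d'" for a' b' c' d' z
    proof -
      obtain x y where "x \<in> closed_segment a b" "dist x z < e" "y \<in> closed_segment c d" "dist y z < e"
        using closed_segment_close[OF close(1,2) z(1)] closed_segment_close[OF close(3,4) z(2)] by blast
      then have "dist x y < r" "r \<le> dist x y"
        using elim dist_triangle2[of x y z] r[of x y] by auto
      then show False by simp
    qed
    then show ?case by blast
  qed
qed

lemma polygon_path_loop:
  assumes "3 \<le> length ws"
  shows "path (polygon_path ws)" "pathfinish (polygon_path ws) = pathstart (polygon_path ws)"
  using polyline_image[of "ws @ [hd ws]"] assms by (auto simp: polygon_path_def hd_append)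

text \<open>
  The straight-line homotopy between two loops that are uniformly close avoids any point at a larger
  distance from the first.
\<close>

lemma winding_number_stable:
  assumes "3 \<le> length ws" "z \<notin> path_image (polygon_path ws)"
  shows "\<forall>\<^sub>F e in at_right 0. \<forall>ws'. length ws' = length ws \<and> (\<forall>i<length ws. dist (ws ! i) (ws' ! i) < e) \<longrightarrow>
    z \<notin> path_image (polygon_path ws') \<and> winding_number (polygon_path ws') z = winding_number (polygon_path ws) z"
proof -
  have "closed (path_image (polygon_path ws))"
    using polygon_path_loop[OF assms(1)] by (simp add: closed_path_image)
  then obtain r where "r > 0" and r: "\<And>x. x \<in> path_image (polygon_path ws) \<Longrightarrow> r \<le> dist z x"
    using separate_point_closed[OF _ assms(2)] by metis
  have "\<forall>\<^sub>F e in at_right 0. e < r"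
    using \<open>r > 0\<close> by (intro eventually_at_rightI[of 0 r]) auto
  then show ?thesis
  proof (eventually_elim, intro allI impI)
    fix e ws' assume e: "e < r" and ws': "length ws' = length ws \<and> (\<forall>i<length ws. dist (ws ! i) (ws' ! i) < e)"
    have len: "3 \<le> length ws'" using ws' assms by simp
    have "dist ((ws @ [hd ws]) ! i) ((ws' @ [hd ws']) ! i) < e" if "i < length (ws @ [hd ws])" for i
    proof -
      have "ws \<noteq> []" "ws' \<noteq> []" using assms(1) len by auto
      moreover from this have "dist (ws ! 0) (ws' ! 0) < e" using ws' by simp
      ultimately show ?thesis using that ws' by (auto simp: nth_append hd_conv_nth)
    qed
    then have near: "dist (polygon_path ws x) (polygon_path ws' x) < e" if "x \<in> {0..1}" for x
      unfolding polygon_path_def using that ws' assms(1) by (intro polyline_close) auto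
    have far: "r \<le> dist z (polygon_path ws x)" if "x \<in> {0..1}" for x
      using r that by (auto simp: path_image_def)
    have "winding_number (polygon_path ws') z = winding_number (polygon_path ws) z"
    proof (rule winding_number_nearby_loops_eq)
      show "norm (polygon_path ws' x - polygon_path ws x) < norm (polygon_path ws x - z)" if "x \<in> {0..1}" for x
        using near[OF that] far[OF that] e by (simp add: dist_norm norm_minus_commute)
    qed (use polygon_path_loop[OF assms(1)] polygon_path_loop[OF len] in auto)
    moreover have "z \<noteq> polygon_path ws' x" if "x \<in> {0..1}" for x
      using near[OF that] far[OF that] e by (auto simp: dist_commute)
    ultimately show "z \<notin> path_image (polygon_path ws') \<and> winding_number (polygon_path ws') z = winding_number (polygon_path ws) z"
      unfolding path_image_def by blast
  qed
qed

lemma is_polygon_adjacent_distinct: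
  assumes "is_polygon ws" "i < length ws"
  shows "vertex ws (Suc i) \<noteq> vertex ws i"
proof -
  have "3 \<le> length ws" "simple_path (polygon_path ws)" using assms(1) by (auto simp: is_polygon_def)
  then show ?thesis using assms(2) by (metis simple_polygon_path_iff)
qed

text \<open>
  Simplicity survives because only finitely many pairs of edges must be kept apart; adjacent edges
  cannot meet twice since their directions are unchanged. For the orientation it is enough to look at a
  single inner point, since the winding number of a simple loop is constant on its inside.
\<close>

lemma is_polygon_stable:
  assumes poly: "is_polygon ws"
  shows "\<forall>\<^sub>F e in at_right 0. \<forall>ws'. length ws' = length ws \<and> (\<forall>i<length ws. dist (ws ! i) (ws' ! i) < e) \<and>
     (\<forall>j\<in>{1..length ws}. edge_tangent ws' j = edge_tangent ws j) \<longrightarrow> is_polygon ws'"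
proof -
  define N where "N = length ws"
  have len: "3 \<le> length ws" and simple: "simple_path (polygon_path ws)"
    and wn: "\<And>z. z \<in> inside (path_image (polygon_path ws)) \<Longrightarrow> winding_number (polygon_path ws) z = 1"
    using poly by (auto simp: is_polygon_def)
  define far where "far i j \<longleftrightarrow> i + 2 \<le> j \<and> j < N \<and> (i = 0 \<longrightarrow> Suc j < N)" for i j
  \<comment> \<open>the point that witnesses the orientation\<close>
  obtain z where z: "z \<in> inside (path_image (polygon_path ws))"
    using Jordan_inside_outside[OF simple polygon_path_loop(2)[OF len]] by blast
  then have "z \<notin> path_image (polygon_path ws)"
    using inside_no_overlap by blast
  then have ev_wn: "\<forall>\<^sub>F e in at_right 0. \<forall>ws'. length ws' = length ws \<and> (\<forall>i<length ws. dist (ws ! i) (ws' ! i) < e) \<longrightarrow>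
    z \<notin> path_image (polygon_path ws') \<and> winding_number (polygon_path ws') z = winding_number (polygon_path ws) z"
    using winding_number_stable[OF len] by blast
  have "\<forall>\<^sub>F e in at_right 0. \<forall>(i, j) \<in> {..<N} \<times> {..<N}. far i j \<longrightarrow> (\<forall>a' b' c' d'. dist (vertex ws i) a' < e \<and>
     dist (vertex ws (Suc i)) b' < e \<and> dist (vertex ws j) c' < e \<and> dist (vertex ws (Suc j)) d' < e \<longrightarrow>
     closed_segment a' b' \<inter> closed_segment c' d' = {})"
    (is "\<forall>\<^sub>F e in _. \<forall>(i, j) \<in> _. ?Q e i j")
  proof (rule eventually_ball_finite, simp, rule ballI)
    fix p assume "p \<in> {..<N} \<times> {..<N}"
    obtain i j where p: "p = (i, j)" by fastforce
    have "\<forall>\<^sub>F e in at_right 0. ?Q e i j"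
    proof (cases "far i j")
      case True
      then have "edge_segment ws i \<inter> edge_segment ws j = {}"
        using len simple by (intro nonadjacent_edges_disjoint) (auto simp: far_def N_def)
      from compact_separation_stable[OF this[unfolded edge_segment_def]] True show ?thesis
        by simp
    qed simp
    then show "\<forall>\<^sub>F e in at_right 0. case p of (i, j) \<Rightarrow> ?Q e i j" by (simp only: p prod.case)
  qed
  with ev_wn show ?thesis
  proof (eventually_elim, intro allI impI, elim conjE)
    fix e ws'
    assume wn': "\<forall>ws'. length ws' = length ws \<and> (\<forall>i<length ws. dist (ws ! i) (ws' ! i) < e) \<longrightarrow>
        z \<notin> path_image (polygon_path ws') \<and> winding_number (polygon_path ws') z = winding_number (polygon_path ws) z"
      and sep: "\<forall>(i, j) \<in> {..<N} \<times> {..<N}. ?Q e i j"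
      and len': "length ws' = length ws" and near: "\<forall>i<length ws. dist (ws ! i) (ws' ! i) < e"
      and tan: "\<forall>j\<in>{1..length ws}. edge_tangent ws' j = edge_tangent ws j"
    have len3: "3 \<le> length ws'" using len len' by simp
    have tan': "edge_tangent ws' j = edge_tangent ws j" if "j \<in> {1..Suc N}" for j
    proof (cases "j = Suc N")
      case True
      then show ?thesis
        using vertex_wrap(4)[OF len] vertex_wrap(4)[OF len3] len' tan len by (simp add: N_def)
    next
      case False
      then show ?thesis using that tan by (simp add: N_def)
    qed
    have ne: "vertex ws' (Suc i) \<noteq> vertex ws' i" if "i < N" for i
    proof
      assume "vertex ws' (Suc i) = vertex ws' i"
      then have "edge_tangent ws' (Suc i) = 0" by (simp add: edge_tangent_def)
      moreover have "edge_tangent ws (Suc i) \<noteq> 0"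
        using edge_vector(3)[of ws "Suc i"] is_polygon_adjacent_distinct[OF poly, of i] that by (auto simp: N_def)
      ultimately show False using tan'[of "Suc i"] that by simp
    qed
    have ne': "vertex ws' (Suc i) \<noteq> vertex ws' i" if "i \<le> N" for i
    proof (cases "i = N")
      case True
      have "0 < N" using len unfolding N_def by linarith
      then show ?thesis using ne[of 0] vertex_wrap(1,2)[OF len3] len' True by (simp add: N_def)
    next
      case False
      then show ?thesis using ne[of i] that by simp
    qed
    have vert: "dist (vertex ws i) (vertex ws' i) < e" for i
    proof -
      have "0 < N" using len unfolding N_def by linarith
      then have "i mod N < N" by (rule mod_less_divisor)
      then show ?thesis using near by (simp add: vertex_def len' N_def)
    qed
    have simple': "simple_path (polygon_path ws')"
    proof (rule simple_polygon_pathI[OF len3])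
      fix i assume "i < length ws'"
      then have i: "i < N" by (simp add: len' N_def)
      have ne1: "vertex ws' (Suc i) \<noteq> vertex ws' (Suc i - 1)" using ne'[of i] i by simp
      have ne2: "vertex ws' (Suc (Suc i)) \<noteq> vertex ws' (Suc (Suc i) - 1)" using ne'[of "Suc i"] i by simp
      show "vertex ws' i \<noteq> vertex ws' (Suc i)" using ne[OF i] by simp
      let ?t = "edge_tangent ws'" and ?l = "edge_length ws'"
      have e: "vertex ws' (Suc i) - vertex ws' i = ?l (Suc i) *\<^sub>R ?t (Suc i)" "?l (Suc i) > 0"
        "vertex ws' (Suc (Suc i)) - vertex ws' (Suc i) = ?l (Suc (Suc i)) *\<^sub>R ?t (Suc (Suc i))" "?l (Suc (Suc i)) > 0"
        using edge_vector(1,2)[OF ne1] edge_vector(1,2)[OF ne2] by simp_all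
      have "cross (?t (Suc i)) (?t (Suc (Suc i))) \<noteq> 0"
        using is_polygon_cross[OF poly, of "Suc i"] tan'[of "Suc i"] tan'[of "Suc (Suc i)"] i by (simp add: N_def)
      then have "cross (?l (Suc i) *\<^sub>R ?t (Suc i)) (?l (Suc (Suc i)) *\<^sub>R ?t (Suc (Suc i))) \<noteq> 0"
        using e(2,4) by (simp add: cross_scaleR)
      then show "edge_segment ws' i \<inter> edge_segment ws' (Suc i) \<subseteq> {vertex ws' (Suc i)}"
        unfolding edge_segment_def e(1,3)[symmetric] by (rule adjacent_segments)
    next
      fix i j assume "i + 2 \<le> j" "j < length ws'" "i = 0 \<longrightarrow> Suc j < length ws'"
      then have "far i j" "(i, j) \<in> {..<N} \<times> {..<N}" by (auto simp: far_def len' N_def)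
      then show "edge_segment ws' i \<inter> edge_segment ws' j = {}"
        using sep vert unfolding edge_segment_def by blast
    qed
    have wz: "winding_number (polygon_path ws') z = 1" "z \<notin> path_image (polygon_path ws')"
      using wn' near len' wn[OF z] by auto
    have "z \<notin> outside (path_image (polygon_path ws'))"
      using winding_number_zero_in_outside[OF polygon_path_loop[OF len3], of z] wz by auto
    then have z': "z \<in> inside (path_image (polygon_path ws'))"
      using wz(2) by (metis ComplI UnE inside_Un_outside)
    have "winding_number (polygon_path ws') x = 1" if "x \<in> inside (path_image (polygon_path ws'))" for x
      using simple_closed_path_winding_number_inside[OF simple'] z' wz(1) that
      by (metis one_neq_neg_one)
    moreover have "outer_angle ws' j = outer_angle ws j" if "j \<in> {1..N}" for j
      using tan'[of j] tan'[of "Suc j"] that by (simp add: outer_angle_def)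
    ultimately show "is_polygon ws'"
      using poly simple' len' by (auto simp: is_polygon_def N_def)
  qed
qed
section \<open>Realising nearby height vectors\<close>

lemma edge_normal_inner:
  "edge_normal ws j \<bullet> x = - cross (edge_tangent ws j) x"
  by (simp add: edge_normal_def cross_def inner_complex_def)

text \<open>Cramer's rule for \<open>u \<bullet> a = \<alpha>\<close>, \<open>u \<bullet> b = \<beta>\<close>.\<close>

definition solve_inner :: "complex \<Rightarrow> complex \<Rightarrow> real \<Rightarrow> real \<Rightarrow> complex" where
  "solve_inner a b \<alpha> \<beta> = (\<beta> *\<^sub>R (\<i> * a) - \<alpha> *\<^sub>R (\<i> * b)) /\<^sub>R cross a b"

lemma solve_inner:
  assumes "cross a b \<noteq> 0"
  shows "solve_inner a b \<alpha> \<beta> \<bullet> a = \<alpha>" "solve_inner a b \<alpha> \<beta> \<bullet> b = \<beta>"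
proof -
  have "(\<i> * a) \<bullet> a = 0" "(\<i> * b) \<bullet> b = 0" "(\<i> * a) \<bullet> b = cross a b" "(\<i> * b) \<bullet> a = - cross a b"
    by (simp_all add: inner_complex_def cross_def)
  then show "solve_inner a b \<alpha> \<beta> \<bullet> a = \<alpha>" "solve_inner a b \<alpha> \<beta> \<bullet> b = \<beta>"
    using assms by (simp_all add: solve_inner_def inner_diff_left)
qed

lemma norm_solve_inner_le:
  assumes "norm a = 1" "norm b = 1" "\<bar>\<alpha>\<bar> \<le> \<epsilon>" "\<bar>\<beta>\<bar> \<le> \<epsilon>"
  shows "norm (solve_inner a b \<alpha> \<beta>) \<le> 2 * \<epsilon> / \<bar>cross a b\<bar>"
proof -
  have "norm (\<beta> *\<^sub>R (\<i> * a) - \<alpha> *\<^sub>R (\<i> * b)) \<le> \<bar>\<beta>\<bar> + \<bar>\<alpha>\<bar>"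
    using norm_triangle_ineq4[of "\<beta> *\<^sub>R (\<i> * a)" "\<alpha> *\<^sub>R (\<i> * b)"] assms by (simp add: norm_mult)
  also have "\<dots> \<le> 2 * \<epsilon>" using assms by simp
  finally show ?thesis
    by (simp add: solve_inner_def divide_inverse mult.commute mult_left_mono)
qed

text \<open>
  The vector \<open>y\<close> is a multiple of \<open>t\<close>. Its coefficient differs from \<open>l\<close> by less than \<open>l\<close>, so it
  is positive.
\<close>

lemma same_direction:
  fixes t x y :: complex
  assumes "norm t = 1" "cross t y = 0" "x = l *\<^sub>R t" "norm (y - x) < l"
  shows "y / norm y = t"
proof -
  define c where "c = Re (cnj t * y)"
  have "cnj t * y = c"
    using assms(2) by (simp add: c_def cross_def complex_eq_iff)
  then have "t * cnj t * y = c * t" by (simp add: mult.commute mult.left_commute)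
  then have y: "y = c *\<^sub>R t"
    using assms(1) by (simp add: complex_norm_square[symmetric] scaleR_conv_of_real)
  have "y - x = (c - l) *\<^sub>R t" by (simp add: y assms(3) scaleR_diff_left)
  then have "\<bar>c - l\<bar> < l" using assms(1,4) by simp
  then have "c > 0" by linarith
  then show ?thesis using y assms(1) by (simp add: scaleR_conv_of_real norm_mult)
qed

text \<open>
  A perturbed edge that is still perpendicular to the old normal could only have been reversed or
  collapsed, which needs a displacement of its end points by half of its length.
\<close>

lemma edge_directions_near:
  assumes "length ws' = length ws" "j \<in> {1..length ws}" "norm (edge_tangent ws j) = 1"
    and near: "\<And>i. i < length ws \<Longrightarrow> dist (ws ! i) (ws' ! i) < e"
    and "2 * e \<le> edge_length ws j"
    and perp: "(vertex ws' j - vertex ws' (j - 1)) \<bullet> edge_normal ws j = 0"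
  shows "edge_tangent ws' j = edge_tangent ws j"
proof -
  let ?y = "vertex ws' j - vertex ws' (j - 1)" and ?x = "vertex ws j - vertex ws (j - 1)"
  have vert: "dist (vertex ws i) (vertex ws' i) < e" for i
  proof -
    have "i mod length ws < length ws" using assms(2) by (intro mod_less_divisor) auto
    then show ?thesis using near by (simp add: vertex_def assms(1))
  qed
  have "?x = edge_length ws j *\<^sub>R edge_tangent ws j"
    using assms(3) by (auto simp: edge_tangent_def edge_length_def scaleR_conv_of_real)
  moreover have "norm (?y - ?x) < edge_length ws j"
  proof -
    have "?y - ?x = (vertex ws' j - vertex ws j) + (vertex ws (j - 1) - vertex ws' (j - 1))" by simp
    then have "norm (?y - ?x) \<le> dist (vertex ws j) (vertex ws' j) + dist (vertex ws (j - 1)) (vertex ws' (j - 1))"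
      by (metis dist_commute dist_norm norm_triangle_ineq)
    then show ?thesis using vert[of j] vert[of "j - 1"] assms(5) by linarith
  qed
  moreover have "cross (edge_tangent ws j) ?y = 0"
    using perp by (metis edge_normal_inner inner_commute neg_equal_0_iff_equal)
  ultimately have "?y / norm ?y = edge_tangent ws j"
    using assms(3) by (intro same_direction)
  then show ?thesis
    by (simp add: edge_tangent_def[of ws'] edge_length_def)
qed

text \<open>
  Each vertex is displaced by the solution of the two equations that prescribe the changes of the
  heights of its two edges. Then both ends of an edge have the prescribed height over the old normal,
  so the edge stays perpendicular to it.
\<close>

lemma heights_realizable:
  assumes "ws \<in> poly_class P"
  shows "\<exists>\<epsilon>>0. \<forall>g. (\<forall>j\<in>{1..length P}. \<bar>g j - height ws j\<bar> \<le> \<epsilon>) \<longrightarrow>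
    (\<exists>\<Sigma>\<in>poly_class P. \<forall>j\<in>{1..length P}. height \<Sigma> j = g j)"
proof -
  define N where "N = length P"
  have poly: "is_polygon ws" and lenw: "length ws = N" and nrm: "\<And>j. j \<in> {1..N} \<Longrightarrow> edge_normal ws j = edge_normal P j"
    using assms by (auto simp: poly_class_def N_def)
  have len: "3 \<le> length ws" using poly by (simp add: is_polygon_def)
  let ?n = "edge_normal ws"
  \<comment> \<open>the edges at the vertex in list position \<open>i\<close> are \<open>prev i\<close> and \<open>Suc i\<close>; position \<open>0\<close> holds vertex \<open>N\<close>\<close>
  define prev where "prev i = (if i = 0 then N else i)" for i
  have prev: "prev i \<in> {1..N}" if "i < N" for i using that by (auto simp: prev_def)
  have tangent_prev: "edge_tangent ws (Suc (prev i)) = edge_tangent ws (Suc i)" for i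
    using vertex_wrap(4)[OF len] by (simp add: prev_def lenw)
  have unit: "norm (edge_tangent ws j) = 1" "edge_length ws j > 0" if "j \<in> {1..N}" for j
  proof -
    have "vertex ws j \<noteq> vertex ws (j - 1)"
    proof -
      have "j - 1 < length ws" "Suc (j - 1) = j" using that by (auto simp: lenw)
      then show ?thesis using is_polygon_adjacent_distinct[OF poly, of "j - 1"] by simp
    qed
    from edge_vector(2,3)[OF this] show "norm (edge_tangent ws j) = 1" "edge_length ws j > 0"
      by simp_all
  qed
  have nunit: "norm (?n j) = 1" if "j \<in> {1..N}" for j
    using unit[OF that] by (simp add: edge_normal_def norm_mult)
  define c where "c i = cross (?n (prev i)) (?n (Suc i))" for i
  have c: "c i \<noteq> 0" if "i < N" for i
  proof -
    have "c i = cross (edge_tangent ws (prev i)) (edge_tangent ws (Suc (prev i)))"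
      unfolding tangent_prev by (simp add: c_def edge_normal_def cross_def)
    then show ?thesis using is_polygon_cross[OF poly, of "prev i"] prev[OF that] by (simp add: lenw)
  qed
  have "\<forall>\<^sub>F e in at_right 0. 0 < e \<and> (\<forall>j\<in>{1..N}. 2 * e \<le> edge_length ws j)"
  proof -
    have "\<forall>\<^sub>F e in at_right 0. 2 * e \<le> edge_length ws j" if "j \<in> {1..N}" for j
      using unit(2)[OF that] by (intro eventually_at_rightI[of 0 "edge_length ws j / 2"]) auto
    then show ?thesis
      by (intro eventually_conj eventually_ball_finite ballI eventually_at_right_less) auto
  qed
  from eventually_happens[OF eventually_conj[OF this is_polygon_stable[OF poly]]]
  obtain e where e: "0 < e" "\<And>j. j \<in> {1..N} \<Longrightarrow> 2 * e \<le> edge_length ws j"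
    and stable: "\<And>ws'. \<lbrakk>length ws' = N; \<And>i. i < N \<Longrightarrow> dist (ws ! i) (ws' ! i) < e;
       \<And>j. j\<in>{1..N} \<Longrightarrow> edge_tangent ws' j = edge_tangent ws j\<rbrakk> \<Longrightarrow> is_polygon ws'"
    unfolding lenw by (auto simp: trivial_limit_at_right_real)
  have "\<forall>\<^sub>F \<epsilon> in at_right 0. 0 < \<epsilon> \<and> (\<forall>i\<in>{..<N}. 2 * \<epsilon> / \<bar>c i\<bar> < e)"
  proof -
    have "\<forall>\<^sub>F \<epsilon> in at_right 0. 2 * \<epsilon> / \<bar>c i\<bar> < e" if "i \<in> {..<N}" for i
      using c[of i] that e(1) by (intro eventually_at_rightI[of 0 "e * \<bar>c i\<bar> / 2"]) (auto simp: field_simps)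
    then show ?thesis
      by (intro eventually_conj eventually_ball_finite ballI eventually_at_right_less) auto
  qed
  from eventually_happens[OF this]
  obtain \<epsilon> where \<epsilon>: "0 < \<epsilon>" "\<And>i. i < N \<Longrightarrow> 2 * \<epsilon> / \<bar>c i\<bar> < e"
    by (auto simp: trivial_limit_at_right_real)
  have "\<exists>\<Sigma>\<in>poly_class P. \<forall>j\<in>{1..N}. height \<Sigma> j = g j"
    if g: "\<forall>j\<in>{1..N}. \<bar>g j - height ws j\<bar> \<le> \<epsilon>" for g
  proof -
    define \<delta> where "\<delta> j = g j - height ws j" for j
    define u where "u i = solve_inner (?n (prev i)) (?n (Suc i)) (\<delta> (prev i)) (\<delta> (Suc i))" for i
    define ws' where "ws' = map (\<lambda>i. ws ! i + u i) [0..<N]"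
    have len': "length ws' = N" by (simp add: ws'_def)
    have near: "dist (ws ! i) (ws' ! i) < e" if "i < N" for i
    proof -
      have "norm (u i) \<le> 2 * \<epsilon> / \<bar>c i\<bar>"
        unfolding u_def c_def using g nunit prev[OF that] that
        by (intro norm_solve_inner_le) (auto simp: \<delta>_def)
      then show ?thesis using \<epsilon>(2)[OF that] that by (simp add: ws'_def dist_norm)
    qed
    have dot: "vertex ws' (j - 1) \<bullet> ?n j = g j" "vertex ws' j \<bullet> ?n j = g j" if j: "j \<in> {1..N}" for j
    proof -
      define i where "i = j - 1"
      have i: "j = Suc i" "i < N" using j by (auto simp: i_def)
      have h: "vertex ws i \<bullet> ?n j = height ws j"
        using inner_edge_normal[of ws j] by (simp add: height_def i inner_diff_left)
      have "vertex ws' i = vertex ws i + u i"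
        using i by (simp add: vertex_def ws'_def lenw)
      then show "vertex ws' (j - 1) \<bullet> ?n j = g j"
        using solve_inner(2)[OF c[OF i(2), unfolded c_def]] h by (simp add: i inner_add_left u_def \<delta>_def)
      have "vertex ws' j = vertex ws j + u (j mod N)" "prev (j mod N) = j" "j mod N < N"
        using i by (auto simp: vertex_def ws'_def lenw prev_def mod_Suc)
      then show "vertex ws' j \<bullet> ?n j = g j"
        using solve_inner(1)[OF c[OF \<open>j mod N < N\<close>, unfolded c_def]]
        by (simp add: inner_add_left u_def \<delta>_def height_def)
    qed
    have tan: "edge_tangent ws' j = edge_tangent ws j" if "j \<in> {1..N}" for j
    proof (rule edge_directions_near)
      show "(vertex ws' j - vertex ws' (j - 1)) \<bullet> ?n j = 0"
        using dot[OF that] by (simp add: inner_diff_left)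
    qed (use unit e that len' near in \<open>auto simp: lenw\<close>)
    have "is_polygon ws'" by (intro stable len' near tan)
    moreover have n': "edge_normal ws' j = ?n j" if "j \<in> {1..N}" for j
      using tan[OF that] by (simp add: edge_normal_def)
    ultimately have "ws' \<in> poly_class P"
      using len' nrm by (auto simp: poly_class_def N_def)
    moreover have "height ws' j = g j" if "j \<in> {1..N}" for j
      using dot(2)[OF that] n'[OF that] by (simp add: height_def)
    ultimately show ?thesis by blast
  qed
  then show ?thesis using \<epsilon>(1) by (auto simp: N_def)
qed

section \<open>A compact neighbourhood of the motion\<close>

lemma height_diff_le_poly_dist:
  assumes "j \<in> {1..N}"
  shows "\<bar>height \<Gamma> j - height \<Sigma> j\<bar> \<le> poly_dist N \<Gamma> \<Sigma>"
  unfolding poly_dist_def using assms by (intro Max_ge) auto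

lemma poly_dist_le_iff:
  assumes "1 \<le> N"
  shows "poly_dist N \<Gamma> \<Sigma> \<le> B \<longleftrightarrow> (\<forall>j\<in>{1..N}. \<bar>height \<Gamma> j - height \<Sigma> j\<bar> \<le> B)"
  unfolding poly_dist_def using assms by (subst Max_le_iff) auto

lemma is_polygon_length: "is_polygon P \<Longrightarrow> 1 \<le> length P"
  by (auto simp: is_polygon_def)

text \<open>
  If all height vectors in a cube belong to polygons, these polygons form a continuous image of the cube.
  Continuity is immediate as the metric is the maximum norm of the heights.
\<close>

lemma compactin_height_box:
  assumes poly: "is_polygon P"
    and real: "\<And>g. \<forall>j\<in>{1..length P}. \<bar>g j - c j\<bar> \<le> r \<Longrightarrow>
      \<exists>\<Sigma>\<in>poly_class P. \<forall>j\<in>{1..length P}. height \<Sigma> j = g j"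
  shows "compactin (poly_topology P) {\<Sigma>\<in>poly_class P. \<forall>j\<in>{1..length P}. \<bar>height \<Sigma> j - c j\<bar> \<le> r}"
proof -
  interpret Metric_space "poly_class P" "poly_dist (length P)"
    by (rule Metric_space_poly_class[OF poly])
  define I where "I = {1..length P}"
  have I: "finite I" "1 \<le> length P" using is_polygon_length[OF poly] by (auto simp: I_def)
  define X where "X = product_topology (\<lambda>_. euclideanreal) I"
  define S where "S = PiE I (\<lambda>j. {c j - r..c j + r})"
  define R where "R g = (SOME \<Sigma>. \<Sigma> \<in> poly_class P \<and> (\<forall>j\<in>I. height \<Sigma> j = g j))" for g
  have R: "R g \<in> poly_class P" "\<And>j. j \<in> I \<Longrightarrow> height (R g) j = g j" if "g \<in> S" for g
  proof -
    have "\<forall>j\<in>I. \<bar>g j - c j\<bar> \<le> r"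
    proof
      fix j assume "j \<in> I"
      then have "g j \<in> {c j - r..c j + r}" using that by (auto simp: S_def)
      then show "\<bar>g j - c j\<bar> \<le> r" by auto
    qed
    then have "\<exists>\<Sigma>. \<Sigma> \<in> poly_class P \<and> (\<forall>j\<in>I. height \<Sigma> j = g j)"
      using real unfolding I_def by blast
    from someI_ex[OF this] show "R g \<in> poly_class P" "\<And>j. j \<in> I \<Longrightarrow> height (R g) j = g j"
      by (auto simp: R_def)
  qed
  have top: "topspace (subtopology X S) = S"
    by (auto simp: X_def S_def PiE_def)
  have "continuous_map (subtopology X S) mtopology R"
    unfolding continuous_map_to_metric top
  proof (intro ballI allI impI)
    fix g and \<epsilon> :: real assume g: "g \<in> S" and "0 < \<epsilon>"
    define V where "V = PiE I (\<lambda>j. {g j - \<epsilon> / 2 <..< g j + \<epsilon> / 2})"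
    have "openin (subtopology X S) (S \<inter> V)"
      using I(1) by (intro openin_subtopology_Int2) (simp add: X_def V_def openin_PiE)
    moreover have "g \<in> S \<inter> V"
      using g \<open>0 < \<epsilon>\<close> by (auto simp: S_def V_def PiE_def)
    moreover have "R g' \<in> mball (R g) \<epsilon>" if g': "g' \<in> S \<inter> V" for g'
    proof -
      have "\<bar>g j - g' j\<bar> \<le> \<epsilon> / 2" if "j \<in> I" for j
      proof -
        have "g' j \<in> {g j - \<epsilon> / 2 <..< g j + \<epsilon> / 2}" using that g' by (auto simp: V_def)
        then show ?thesis unfolding greaterThanLessThan_iff abs_le_iff by linarith
      qed
      then have "poly_dist (length P) (R g) (R g') \<le> \<epsilon> / 2"
        using R[OF g] R[of g'] g' unfolding poly_dist_le_iff[OF I(2)] by (simp add: I_def)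
      then show ?thesis using R(1)[OF g] R(1)[of g'] g' \<open>0 < \<epsilon>\<close> by simp
    qed
    ultimately show "\<exists>U. openin (subtopology X S) U \<and> g \<in> U \<and> (\<forall>g'\<in>U. R g' \<in> mball (R g) \<epsilon>)"
      by blast
  qed
  moreover have "compactin (subtopology X S) S"
    by (simp add: compactin_subtopology X_def S_def compactin_PiE)
  ultimately have "compactin mtopology (R ` S)"
    by (rule image_compactin[rotated])
  moreover have "R ` S = {\<Sigma>\<in>poly_class P. \<forall>j\<in>I. \<bar>height \<Sigma> j - c j\<bar> \<le> r}"
  proof (intro equalityI subsetI)
    fix \<Sigma> assume "\<Sigma> \<in> R ` S"
    then obtain g where g: "g \<in> S" "\<Sigma> = R g" by blast
    moreover have "\<bar>g j - c j\<bar> \<le> r" if "j \<in> I" for j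
    proof -
      have "g j \<in> {c j - r..c j + r}" using that g(1) by (auto simp: S_def)
      then show ?thesis by auto
    qed
    ultimately show "\<Sigma> \<in> {\<Sigma>\<in>poly_class P. \<forall>j\<in>I. \<bar>height \<Sigma> j - c j\<bar> \<le> r}"
      using R[OF g(1)] by simp
  next
    fix \<Sigma> assume \<Sigma>: "\<Sigma> \<in> {\<Sigma>\<in>poly_class P. \<forall>j\<in>I. \<bar>height \<Sigma> j - c j\<bar> \<le> r}"
    define g where "g = restrict (height \<Sigma>) I"
    have "g \<in> S"
      unfolding S_def g_def
    proof (rule restrict_PiE_iff[THEN iffD2], rule ballI)
      fix j assume "j \<in> I"
      then have "\<bar>height \<Sigma> j - c j\<bar> \<le> r" using \<Sigma> by simp
      then show "height \<Sigma> j \<in> {c j - r..c j + r}" by (auto simp: abs_le_iff)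
    qed
    moreover have "\<Sigma> = R g"
      using \<Sigma> R[OF \<open>g \<in> S\<close>] by (intro heights_determine_polygon) (auto simp: g_def I_def)
    ultimately show "\<Sigma> \<in> R ` S" by blast
  qed
  ultimately show ?thesis
    by (simp add: poly_topology_def I_def)
qed

lemma heights_realizable_in_open:
  assumes poly: "is_polygon P" and "openin (poly_topology P) U" "\<Gamma> \<in> U"
  shows "\<exists>\<epsilon>>0. \<forall>g. (\<forall>j\<in>{1..length P}. \<bar>g j - height \<Gamma> j\<bar> \<le> \<epsilon>) \<longrightarrow>
    (\<exists>\<Sigma>\<in>U. \<forall>j\<in>{1..length P}. height \<Sigma> j = g j)"
proof -
  interpret Metric_space "poly_class P" "poly_dist (length P)"
    by (rule Metric_space_poly_class[OF poly])
  obtain r where r: "r > 0" "mcball \<Gamma> r \<subseteq> U" and \<Gamma>: "\<Gamma> \<in> poly_class P"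
    using assms(2,3) unfolding poly_topology_def openin_mtopology_mcball by blast
  obtain \<epsilon> where \<epsilon>: "\<epsilon> > 0" "\<And>g. \<forall>j\<in>{1..length P}. \<bar>g j - height \<Gamma> j\<bar> \<le> \<epsilon> \<Longrightarrow>
    \<exists>\<Sigma>\<in>poly_class P. \<forall>j\<in>{1..length P}. height \<Sigma> j = g j"
    using heights_realizable[OF \<Gamma>] by blast
  have "\<exists>\<Sigma>\<in>U. \<forall>j\<in>{1..length P}. height \<Sigma> j = g j"
    if g: "\<forall>j\<in>{1..length P}. \<bar>g j - height \<Gamma> j\<bar> \<le> min r \<epsilon>" for g
  proof -
    obtain \<Sigma> where \<Sigma>: "\<Sigma>\<in>poly_class P" "\<forall>j\<in>{1..length P}. height \<Sigma> j = g j"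
      using \<epsilon>(2)[of g] g by auto
    then have "poly_dist (length P) \<Gamma> \<Sigma> \<le> r"
      using g by (simp add: poly_dist_le_iff[OF is_polygon_length[OF poly]] abs_minus_commute)
    then have "\<Sigma> \<in> U" using \<Gamma> \<Sigma>(1) r(2) by auto
    then show ?thesis using \<Sigma>(2) by blast
  qed
  then show ?thesis using r(1) \<epsilon>(1) by (intro exI[of _ "min r \<epsilon>"]) auto
qed

text \<open>
  The Lipschitz hypothesis concerns compact sets, while the scheme needs a uniform neighbourhood of the
  motion on which to work; \<open>K\<close> is both. It is a finite union of compact cubes around polygons of the
  motion. The polygons at nearby times lie in the inner half of such a cube, which leaves the other half
  for \<open>r\<close>.
\<close>

lemma compact_tube:
  fixes \<Gamma> :: "real \<Rightarrow> complex list"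
  assumes poly: "is_polygon P" and U: "openin (poly_topology P) U" and "0 \<le> T"
    and \<Gamma>: "\<And>t. t \<in> {0..T} \<Longrightarrow> \<Gamma> t \<in> U"
    and cont: "\<And>j. j \<in> {1..length P} \<Longrightarrow> continuous_on {0..T} (\<lambda>t. height (\<Gamma> t) j)"
  obtains K r where "compactin (poly_topology P) K" "K \<subseteq> U" "0 < r"
    "\<And>t g. t \<in> {0..T} \<Longrightarrow> \<forall>j\<in>{1..length P}. \<bar>g j - height (\<Gamma> t) j\<bar> \<le> r \<Longrightarrow>
      \<exists>\<Sigma>\<in>K. \<forall>j\<in>{1..length P}. height \<Sigma> j = g j"
proof -
  let ?I = "{1..length P}"
  have "\<forall>s\<in>{0..T}. \<exists>\<epsilon>>0. \<forall>g. (\<forall>j\<in>?I. \<bar>g j - height (\<Gamma> s) j\<bar> \<le> \<epsilon>) \<longrightarrow>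
      (\<exists>\<Sigma>\<in>U. \<forall>j\<in>?I. height \<Sigma> j = g j)"
    using heights_realizable_in_open[OF poly U] \<Gamma> by blast
  then obtain \<epsilon> where \<epsilon>: "\<And>s. s \<in> {0..T} \<Longrightarrow> \<epsilon> s > 0"
    and real: "\<And>s g. s \<in> {0..T} \<Longrightarrow> \<forall>j\<in>?I. \<bar>g j - height (\<Gamma> s) j\<bar> \<le> \<epsilon> s \<Longrightarrow> \<exists>\<Sigma>\<in>U. \<forall>j\<in>?I. height \<Sigma> j = g j"
    by metis
  have sub: "U \<subseteq> poly_class P"
    using openin_subset[OF U] Metric_space.topspace_mtopology[OF Metric_space_poly_class[OF poly]]
    by (simp add: poly_topology_def)
  define B where "B s = {\<Sigma>\<in>poly_class P. \<forall>j\<in>?I. \<bar>height \<Sigma> j - height (\<Gamma> s) j\<bar> \<le> \<epsilon> s}" for s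
  have B_compact: "compactin (poly_topology P) (B s)" if "s \<in> {0..T}" for s
    unfolding B_def using real[OF that] sub by (intro compactin_height_box[OF poly]) blast
  have B_sub: "B s \<subseteq> U" if s: "s \<in> {0..T}" for s
  proof
    fix \<Sigma> assume \<Sigma>: "\<Sigma> \<in> B s"
    then obtain \<Sigma>' where "\<Sigma>' \<in> U" "\<forall>j\<in>?I. height \<Sigma>' j = height \<Sigma> j"
      using real[OF s, of "height \<Sigma>"] by (auto simp: B_def)
    moreover have "\<Sigma>' = \<Sigma>"
      using calculation \<Sigma> sub by (intro heights_determine_polygon) (auto simp: B_def)
    ultimately show "\<Sigma> \<in> U" by simp
  qed
  have "\<exists>\<delta>>0. \<forall>t\<in>{0..T}. dist t s < \<delta> \<longrightarrow> (\<forall>j\<in>?I. \<bar>height (\<Gamma> t) j - height (\<Gamma> s) j\<bar> < \<epsilon> s / 2)"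
    if s: "s \<in> {0..T}" for s
  proof -
    have "\<forall>\<^sub>F t in at s within {0..T}. \<forall>j\<in>?I. \<bar>height (\<Gamma> t) j - height (\<Gamma> s) j\<bar> < \<epsilon> s / 2"
    proof (rule eventually_ball_finite, simp, rule ballI)
      fix j assume "j \<in> ?I"
      then have "((\<lambda>t. height (\<Gamma> t) j) \<longlongrightarrow> height (\<Gamma> s) j) (at s within {0..T})"
        using cont s by (auto simp: continuous_on)
      from tendstoD[OF this, of "\<epsilon> s / 2"] \<epsilon>[OF s]
      show "\<forall>\<^sub>F t in at s within {0..T}. \<bar>height (\<Gamma> t) j - height (\<Gamma> s) j\<bar> < \<epsilon> s / 2"
        by (simp add: dist_real_def)
    qed
    then obtain \<delta> where "\<delta> > 0" "\<forall>t\<in>{0..T}. t \<noteq> s \<and> dist t s < \<delta> \<longrightarrow>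
       (\<forall>j\<in>?I. \<bar>height (\<Gamma> t) j - height (\<Gamma> s) j\<bar> < \<epsilon> s / 2)"
      unfolding eventually_at by blast
    moreover have "\<forall>j\<in>?I. \<bar>height (\<Gamma> s) j - height (\<Gamma> s) j\<bar> < \<epsilon> s / 2"
      using \<epsilon>[OF s] by simp
    ultimately show ?thesis by metis
  qed
  then obtain \<delta> where \<delta>: "\<And>s. s \<in> {0..T} \<Longrightarrow> \<delta> s > 0"
    and near: "\<And>s t j. s \<in> {0..T} \<Longrightarrow> t \<in> {0..T} \<Longrightarrow> dist t s < \<delta> s \<Longrightarrow> j \<in> ?I \<Longrightarrow>
      \<bar>height (\<Gamma> t) j - height (\<Gamma> s) j\<bar> < \<epsilon> s / 2"
    by metis
  have "{0..T} \<subseteq> (\<Union>s\<in>{0..T}. ball s (\<delta> s))"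
    using \<delta> by force
  then obtain D where D: "D \<subseteq> {0..T}" "finite D" "{0..T} \<subseteq> (\<Union>s\<in>D. ball s (\<delta> s))"
    using compactE_image[OF compact_Icc, of "{0..T}" "\<lambda>s. ball s (\<delta> s)" 0 T] by (metis open_ball)
  have "D \<noteq> {}" using D(3) \<open>0 \<le> T\<close> by auto
  define r where "r = Min ((\<lambda>s. \<epsilon> s / 2) ` D)"
  have r: "r \<le> \<epsilon> s / 2" if "s \<in> D" for s
    using that D(2) unfolding r_def by (intro Min_le) auto
  show thesis
  proof
    show "compactin (poly_topology P) (\<Union>(B ` D))"
      using D B_compact by (intro compactin_Union) auto
    show "\<Union>(B ` D) \<subseteq> U" using B_sub D(1) by blast
    show "0 < r" using D \<open>D \<noteq> {}\<close> \<epsilon> by (auto simp: r_def)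
    fix t g assume t: "t \<in> {0..T}" and g: "\<forall>j\<in>?I. \<bar>g j - height (\<Gamma> t) j\<bar> \<le> r"
    then obtain s where s: "s \<in> D" "dist t s < \<delta> s" using D(3) by (force simp: dist_commute)
    have s': "s \<in> {0..T}" using s(1) D(1) by blast
    have g': "\<forall>j\<in>?I. \<bar>g j - height (\<Gamma> s) j\<bar> \<le> \<epsilon> s"
    proof
      fix j assume "j \<in> ?I"
      then show "\<bar>g j - height (\<Gamma> s) j\<bar> \<le> \<epsilon> s"
        using near[OF s' t s(2) \<open>j \<in> ?I\<close>] bspec[OF g \<open>j \<in> ?I\<close>] r[OF s(1)] by linarith
    qed
    then obtain \<Sigma> where "\<Sigma> \<in> U" "\<forall>j\<in>?I. height \<Sigma> j = g j" using real[OF s'] by blast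
    moreover from this have "\<Sigma> \<in> B s" using g' sub by (auto simp: B_def)
    ultimately show "\<exists>\<Sigma>\<in>\<Union>(B ` D). \<forall>j\<in>?I. height \<Sigma> j = g j" using s(1) by blast
  qed
qed

section \<open>Solvability of one implicit step\<close>

text \<open>
  The unknown is taken to be the midpoint \<open>M\<close> and not \<open>\<Sigma>\<close>, since \<open>F\<close> is evaluated there: then the
  scheme is the fixed point equation \<open>h(M) = h(G) + ((s' - s)/2) F(M)\<close>, and the two conditions on
  the step size say that its right-hand side halves distances and maps the ball of radius \<open>\<rho>/2\<close> about \<open>G\<close>
  to itself. The polygon \<open>\<Sigma>\<close> is the reflection of \<open>G\<close> in \<open>M\<close>, hence at distance at most
  \<open>\<rho>\<close>.
\<close>

lemma unique_implicit_step:
  assumes poly: "is_polygon P" and U: "U \<subseteq> poly_class P" and G: "G \<in> poly_class P" and "0 < \<rho>"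
    and real: "\<And>g. \<forall>j\<in>{1..length P}. \<bar>g j - height G j\<bar> \<le> \<rho> \<Longrightarrow> \<exists>\<Sigma>\<in>U. \<forall>j\<in>{1..length P}. height \<Sigma> j = g j"
    and lip: "\<And>M M' j. \<lbrakk>M \<in> U; M' \<in> U; poly_dist (length P) G M \<le> \<rho> / 2; poly_dist (length P) G M' \<le> \<rho> / 2; j \<in> {1..length P}\<rbrakk>
       \<Longrightarrow> \<bar>F M ((s + s') / 2) j - F M' ((s + s') / 2) j\<bar> \<le> L * poly_dist (length P) M M'"
    and bound: "\<And>M j. \<lbrakk>M \<in> U; poly_dist (length P) G M \<le> \<rho> / 2; j \<in> {1..length P}\<rbrakk> \<Longrightarrow> \<bar>F M ((s + s') / 2) j\<bar> \<le> B"
    and step: "s < s'" "(s' - s) * L \<le> 1" "(s' - s) * B \<le> \<rho>"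
  shows "\<exists>\<Sigma>\<in>U. scheme_step P U F s s' G \<Sigma> \<and> poly_dist (length P) G \<Sigma> \<le> \<rho> \<and>
    (\<forall>\<Sigma>'\<in>U. scheme_step P U F s s' G \<Sigma>' \<and> poly_dist (length P) G \<Sigma>' \<le> \<rho> \<longrightarrow> \<Sigma>' = \<Sigma>)"
proof -
  define N where "N = length P"
  define I where "I = {1..N}"
  define h where "h = s' - s"
  define f where "f M = F M ((s + s') / 2)" for M
  have h: "0 < h" "h * L \<le> 1" "h * B \<le> \<rho>" using step by (auto simp: h_def)
  note le_iff = poly_dist_le_iff[OF is_polygon_length[OF poly], folded N_def, folded I_def]
  note real = real[folded N_def, folded I_def]
  note lip = lip[folded N_def f_def, folded I_def]
  note bound = bound[folded N_def f_def, folded I_def]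
  interpret Metric_space "poly_class P" "poly_dist N"
    unfolding N_def by (rule Metric_space_poly_class[OF poly])
  have det: "\<Sigma> = \<Sigma>'" if "\<Sigma> \<in> poly_class P" "\<Sigma>' \<in> poly_class P" "\<And>j. j \<in> I \<Longrightarrow> height \<Sigma> j = height \<Sigma>' j" for \<Sigma> \<Sigma>'
    using heights_determine_polygon[OF that(1,2)] that(3) by (simp add: I_def N_def)
  have real_ball: "\<exists>\<Sigma>\<in>U. poly_dist N G \<Sigma> \<le> q \<and> (\<forall>j\<in>I. height \<Sigma> j = g j)"
    if "\<forall>j\<in>I. \<bar>g j - height G j\<bar> \<le> q" "q \<le> \<rho>" for g q
  proof -
    have "\<forall>j\<in>I. \<bar>g j - height G j\<bar> \<le> \<rho>" using that by force
    then obtain \<Sigma> where "\<Sigma> \<in> U" "\<forall>j\<in>I. height \<Sigma> j = g j" using real[of g] by blast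
    moreover from this have "poly_dist N G \<Sigma> \<le> q"
      using that(1) by (simp add: le_iff abs_minus_commute)
    ultimately show ?thesis by blast
  qed
  define A where "A = {M\<in>poly_class P. \<forall>j\<in>I. \<bar>height M j - height G j\<bar> \<le> \<rho> / 2}"
  have A_iff: "M \<in> A \<longleftrightarrow> M \<in> U \<and> poly_dist N G M \<le> \<rho> / 2" for M
  proof
    assume M: "M \<in> A"
    then obtain M' where "M' \<in> U" "\<forall>j\<in>I. height M' j = height M j"
      using real_ball[of "height M" "\<rho> / 2"] \<open>0 < \<rho>\<close> by (auto simp: A_def)
    moreover have "M' = M" using det[of M' M] calculation M U by (auto simp: A_def)
    ultimately show "M \<in> U \<and> poly_dist N G M \<le> \<rho> / 2"
      using M unfolding le_iff by (simp add: A_def abs_minus_commute)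
  next
    assume "M \<in> U \<and> poly_dist N G M \<le> \<rho> / 2"
    then show "M \<in> A" using U unfolding le_iff by (auto simp: A_def abs_minus_commute)
  qed
  interpret Submetric "poly_class P" "poly_dist N" A
    by unfold_locales (auto simp: A_def)
  have "compactin mtopology A"
  proof -
    have "\<exists>\<Sigma>\<in>poly_class P. \<forall>j\<in>I. height \<Sigma> j = g j" if "\<forall>j\<in>I. \<bar>g j - height G j\<bar> \<le> \<rho> / 2" for g
      using real_ball[OF that] U \<open>0 < \<rho>\<close> by auto
    then show ?thesis
      using compactin_height_box[OF poly, of "height G" "\<rho> / 2"]
      unfolding A_def I_def N_def poly_topology_def by blast
  qed
  then have complete: sub.mcomplete by (rule compactin_imp_mcomplete)
  define \<Phi> where "\<Phi> M = (SOME M'. M' \<in> A \<and> (\<forall>j\<in>I. height M' j = height G j + h / 2 * f M j))" for M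
  have \<Phi>: "\<Phi> M \<in> A" "\<And>j. j \<in> I \<Longrightarrow> height (\<Phi> M) j = height G j + h / 2 * f M j" if M: "M \<in> A" for M
  proof -
    have "\<bar>(height G j + h / 2 * f M j) - height G j\<bar> \<le> \<rho> / 2" if "j \<in> I" for j
    proof -
      have "\<bar>h / 2 * f M j\<bar> \<le> h / 2 * B"
        using bound[of M j] M that h(1) by (simp add: A_iff abs_mult)
      then show ?thesis using h(3) by simp
    qed
    then have "\<exists>M'. M' \<in> A \<and> (\<forall>j\<in>I. height M' j = height G j + h / 2 * f M j)"
      using real_ball[of "\<lambda>j. height G j + h / 2 * f M j" "\<rho> / 2"] \<open>0 < \<rho>\<close> by (auto simp: A_iff)
    from someI_ex[OF this] show "\<Phi> M \<in> A" "\<And>j. j \<in> I \<Longrightarrow> height (\<Phi> M) j = height G j + h / 2 * f M j"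
      by (auto simp: \<Phi>_def)
  qed
  have contraction: "poly_dist N (\<Phi> M) (\<Phi> M') \<le> 1 / 2 * poly_dist N M M'" if "M \<in> A" "M' \<in> A" for M M'
    unfolding le_iff
  proof
    fix j assume j: "j \<in> I"
    have "height (\<Phi> M) j - height (\<Phi> M') j = h / 2 * (f M j - f M' j)"
      using \<Phi>(2)[OF that(1) j] \<Phi>(2)[OF that(2) j] by (simp add: algebra_simps)
    then have "\<bar>height (\<Phi> M) j - height (\<Phi> M') j\<bar> = \<bar>h / 2 * (f M j - f M' j)\<bar>"
      by (simp only:)
    also have "\<dots> = h / 2 * \<bar>f M j - f M' j\<bar>"
      unfolding abs_mult using h(1) by simp
    also have "\<dots> \<le> h / 2 * (L * poly_dist N M M')"
      using lip[of M M' j] that j h(1) by (simp add: A_iff)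
    also have "\<dots> = (h * L) * (1 / 2 * poly_dist N M M')" by simp
    also have "\<dots> \<le> 1 * (1 / 2 * poly_dist N M M')"
      using h(2) by (intro mult_right_mono) auto
    finally show "\<bar>height (\<Phi> M) j - height (\<Phi> M') j\<bar> \<le> 1 / 2 * poly_dist N M M'" by simp
  qed
  have "G \<in> A" using G \<open>0 < \<rho>\<close> by (simp add: A_def)
  then have "A \<noteq> {}" by blast
  moreover have "\<Phi> \<in> A \<rightarrow> A" using \<Phi>(1) by blast
  ultimately obtain M where M: "M \<in> A" "\<Phi> M = M"
    using sub.Banach_fixedpoint_thm[OF complete, of \<Phi> "1 / 2"] contraction by auto
  have fixed: "M' = M" if "M' \<in> A" "\<Phi> M' = M'" for M'
    using sub.contraction_imp_unique_fixpoint[of \<Phi> M' M "1 / 2"] that M contraction \<open>\<Phi> \<in> A \<rightarrow> A\<close> by simp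
  have hM: "height M j = height G j + h / 2 * f M j" if "j \<in> I" for j
    using \<Phi>(2)[OF M(1) that] M(2) by simp
  have "\<forall>j\<in>I. \<bar>(2 * height M j - height G j) - height G j\<bar> \<le> \<rho>"
  proof
    fix j assume "j \<in> I"
    then have "\<bar>height M j - height G j\<bar> \<le> \<rho> / 2" using M(1) by (simp add: A_def)
    then show "\<bar>(2 * height M j - height G j) - height G j\<bar> \<le> \<rho>" by linarith
  qed
  then obtain \<Sigma> where \<Sigma>: "\<Sigma> \<in> U" "poly_dist N G \<Sigma> \<le> \<rho>" "\<And>j. j \<in> I \<Longrightarrow> height \<Sigma> j = 2 * height M j - height G j"
    using real_ball[of "\<lambda>j. 2 * height M j - height G j" \<rho>] by blast
  have "scheme_step P U F s s' G \<Sigma>"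
    unfolding scheme_step_def is_midpoint_def N_def[symmetric] I_def[symmetric] h_def[symmetric] f_def[symmetric]
    using M(1) hM \<Sigma>(3) h(1) U by (intro bexI[of _ M]) (auto simp: A_iff)
  moreover have "\<Sigma>' = \<Sigma>" if \<Sigma>': "\<Sigma>' \<in> U" "scheme_step P U F s s' G \<Sigma>'" "poly_dist N G \<Sigma>' \<le> \<rho>" for \<Sigma>'
  proof -
    obtain M' where M': "M' \<in> U" "\<And>j. j \<in> I \<Longrightarrow> height M' j = (height G j + height \<Sigma>' j) / 2"
      "\<And>j. j \<in> I \<Longrightarrow> (height \<Sigma>' j - height G j) / h = f M' j"
      using \<Sigma>'(2) unfolding scheme_step_def is_midpoint_def N_def[symmetric] I_def[symmetric] h_def[symmetric] f_def[symmetric]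
      by blast
    have "\<bar>height M' j - height G j\<bar> \<le> \<rho> / 2" if "j \<in> I" for j
    proof -
      have eq: "height M' j - height G j = (height \<Sigma>' j - height G j) / 2"
        using M'(2)[OF that] by (simp add: field_simps)
      have "\<bar>height \<Sigma>' j - height G j\<bar> \<le> \<rho>"
        using \<Sigma>'(3) that unfolding le_iff by (metis abs_minus_commute)
      then show ?thesis unfolding eq abs_divide by simp
    qed
    then have "M' \<in> A" using M'(1) U by (auto simp: A_def)
    moreover have "\<Phi> M' = M'"
    proof (rule det)
      show "height (\<Phi> M') j = height M' j" if "j \<in> I" for j
      proof -
        have "h * f M' j = height \<Sigma>' j - height G j"
          using M'(3)[OF that, symmetric] h(1) by simp
        then show ?thesis
          using \<Phi>(2)[OF \<open>M' \<in> A\<close> that] M'(2)[OF that] by (simp add: diff_divide_distrib add_divide_distrib)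
      qed
    qed (use \<Phi>(1)[OF \<open>M' \<in> A\<close>] \<open>M' \<in> A\<close> subset in auto)
    ultimately have "M' = M" by (rule fixed)
    show ?thesis
    proof (rule det)
      show "height \<Sigma>' j = height \<Sigma> j" if "j \<in> I" for j
        using \<Sigma>(3)[OF that] M'(2)[OF that] unfolding \<open>M' = M\<close> add_divide_distrib by linarith
    qed (use \<Sigma>(1) \<Sigma>'(1) U in blast)+
  qed
  ultimately show ?thesis using \<Sigma>(1,2) unfolding N_def by blast
qed

section \<open>Truncation errors of the midpoint rule\<close>

text \<open>
  The supremum of the oscillations over distances up to \<open>a\<close> is monotone in \<open>a\<close>, as is required of the error
  bound.
\<close>

lemma modulus_of_continuity:
  fixes f :: "real \<Rightarrow> real"
  assumes f: "continuous_on {0..T} f" and "0 \<le> T"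
  obtains \<mu> :: "real \<Rightarrow> real" where "mono_on {0<..} \<mu>" "\<And>a. 0 < a \<Longrightarrow> 0 \<le> \<mu> a" "(\<mu> \<longlongrightarrow> 0) (at_right 0)"
    "\<And>a s t. \<lbrakk>0 < a; s \<in> {0..T}; t \<in> {0..T}; \<bar>s - t\<bar> \<le> a\<rbrakk> \<Longrightarrow> \<bar>f s - f t\<bar> \<le> \<mu> a"
proof -
  define W where "W a = {\<bar>f s - f t\<bar> | s t. s \<in> {0..T} \<and> t \<in> {0..T} \<and> \<bar>s - t\<bar> \<le> a}" for a
  define \<mu> where "\<mu> a = Sup (W a)" for a
  have "bounded (f ` {0..T})"
    using f by (intro compact_imp_bounded compact_continuous_image) auto
  then obtain B where B: "\<And>s. s \<in> {0..T} \<Longrightarrow> \<bar>f s\<bar> \<le> B"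
    unfolding bounded_iff by (metis imageI real_norm_def)
  have bdd: "bdd_above (W a)" for a
  proof (rule bdd_aboveI)
    fix x assume "x \<in> W a"
    then obtain s t where "s \<in> {0..T}" "t \<in> {0..T}" "x = \<bar>f s - f t\<bar>" by (auto simp: W_def)
    then show "x \<le> 2 * B" using B[of s] B[of t] by linarith
  qed
  have zero: "0 \<in> W a" if "0 < a" for a
    unfolding W_def using that \<open>0 \<le> T\<close> by (intro CollectI exI[of _ 0]) auto
  have upper: "\<bar>f s - f t\<bar> \<le> \<mu> a" if "s \<in> {0..T}" "t \<in> {0..T}" "\<bar>s - t\<bar> \<le> a" for a s t
    unfolding \<mu>_def using that by (intro cSup_upper bdd) (auto simp: W_def)
  have nonneg: "0 \<le> \<mu> a" if "0 < a" for a
    using zero[OF that] unfolding \<mu>_def by (intro cSup_upper bdd)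
  show thesis
  proof
    show "mono_on {0<..} \<mu>"
    proof (rule mono_onI)
      fix a b :: real assume "a \<in> {0<..}" "a \<le> b"
      then have "W a \<noteq> {}" using zero[of a] by auto
      moreover have "W a \<subseteq> W b" unfolding W_def by (rule Collect_mono) (use \<open>a \<le> b\<close> order_trans in blast)
      ultimately show "\<mu> a \<le> \<mu> b" unfolding \<mu>_def by (intro cSup_subset_mono bdd)
    qed
    show "(\<mu> \<longlongrightarrow> 0) (at_right 0)"
    proof (rule tendstoI)
      fix \<epsilon> :: real assume "0 < \<epsilon>"
      have "uniformly_continuous_on {0..T} f"
        using f by (intro compact_uniformly_continuous) auto
      then obtain d where "0 < d" and d: "\<And>s t. s \<in> {0..T} \<Longrightarrow> t \<in> {0..T} \<Longrightarrow> dist t s < d \<Longrightarrow> dist (f t) (f s) < \<epsilon> / 2"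
        using \<open>0 < \<epsilon>\<close> unfolding uniformly_continuous_on_def by (meson half_gt_zero)
      have "dist (\<mu> a) 0 < \<epsilon>" if a: "0 < a" "a < d" for a
      proof -
        have "\<mu> a \<le> \<epsilon> / 2"
          unfolding \<mu>_def
        proof (rule cSup_least)
          fix x assume "x \<in> W a"
          then obtain s t where "s \<in> {0..T}" "t \<in> {0..T}" "\<bar>s - t\<bar> \<le> a" "x = \<bar>f s - f t\<bar>" by (auto simp: W_def)
          then show "x \<le> \<epsilon> / 2" using d[of t s] a by (simp add: dist_real_def)
        qed (use zero[OF a(1)] in auto)
        then show ?thesis using nonneg[OF a(1)] \<open>0 < \<epsilon>\<close> by simp
      qed
      then show "\<forall>\<^sub>F a in at_right 0. dist (\<mu> a) 0 < \<epsilon>"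
        using \<open>0 < d\<close> by (intro eventually_at_rightI[of 0 d]) auto
    qed
  qed (use nonneg upper in auto)
qed

lemma DERIV_reflected:
  fixes f f' :: "real \<Rightarrow> real"
  assumes "\<And>x. x \<in> {m - h..m + h} \<Longrightarrow> (f has_real_derivative f' x) (at x within {m - h..m + h})"
    and "x \<in> {0..h}"
  shows "((\<lambda>x. f (m + x)) has_real_derivative f' (m + x)) (at x within {0..h})"
    "((\<lambda>x. f (m - x)) has_real_derivative - f' (m - x)) (at x within {0..h})"
proof -
  have "((f \<circ> (\<lambda>x. m + x)) has_real_derivative f' (m + x) * 1) (at x within {0..h})"
    using assms(2) by (intro DERIV_image_chain DERIV_subset[OF assms(1)]) (auto intro!: derivative_eq_intros)
  then show "((\<lambda>x. f (m + x)) has_real_derivative f' (m + x)) (at x within {0..h})"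
    by (simp add: o_def)
  have "((f \<circ> (\<lambda>x. m - x)) has_real_derivative f' (m - x) * -1) (at x within {0..h})"
    using assms(2) by (intro DERIV_image_chain DERIV_subset[OF assms(1)]) (auto intro!: derivative_eq_intros)
  then show "((\<lambda>x. f (m - x)) has_real_derivative - f' (m - x)) (at x within {0..h})"
    by (simp add: o_def)
qed

text \<open>
  The function \<open>x \<mapsto> f(m + x) + f(m - x)\<close> has the derivative \<open>f'(m + x) - f'(m - x)\<close>.
\<close>

lemma second_difference_le:
  fixes f f' :: "real \<Rightarrow> real"
  assumes f: "\<And>x. x \<in> {m - h..m + h} \<Longrightarrow> (f has_real_derivative f' x) (at x within {m - h..m + h})"
    and w: "\<And>x y. \<lbrakk>x \<in> {m - h..m + h}; y \<in> {m - h..m + h}\<rbrakk> \<Longrightarrow> \<bar>f' x - f' y\<bar> \<le> w" and "0 \<le> h"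
  shows "\<bar>f (m + h) + f (m - h) - 2 * f m\<bar> \<le> h * w"
proof -
  let ?g = "\<lambda>x. f (m + x) + f (m - x)" and ?g' = "\<lambda>x. f' (m + x) + - f' (m - x)"
  have "norm (?g h - ?g 0) \<le> w * norm (h - 0)"
  proof (rule field_differentiable_bound)
    show "(?g has_field_derivative ?g' x) (at x within {0..h})" if "x \<in> {0..h}" for x
      using DERIV_reflected[OF f that] by (intro DERIV_add)
    show "norm (?g' x) \<le> w" if "x \<in> {0..h}" for x
      using w[of "m + x" "m - x"] that by simp
  qed (use \<open>0 \<le> h\<close> in auto)
  then show ?thesis using \<open>0 \<le> h\<close> by (simp add: mult.commute)
qed

text \<open>
  The function \<open>x \<mapsto> f(m + x) - f(m - x) - 2 x f'(m)\<close> has the second difference of \<open>f'\<close> as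
  its derivative, which allows \<open>second_difference_le\<close> to be applied to \<open>f'\<close> if that is differentiable.
\<close>

lemma midpoint_rule_le:
  fixes f f' :: "real \<Rightarrow> real"
  assumes f: "\<And>x. x \<in> {m - h..m + h} \<Longrightarrow> (f has_real_derivative f' x) (at x within {m - h..m + h})"
    and w: "\<And>x. x \<in> {0..h} \<Longrightarrow> \<bar>f' (m + x) + f' (m - x) - 2 * f' m\<bar> \<le> w" and "0 \<le> h"
  shows "\<bar>f (m + h) - f (m - h) - 2 * h * f' m\<bar> \<le> h * w"
proof -
  let ?g = "\<lambda>x. f (m + x) - f (m - x) - x * (2 * f' m)" and ?g' = "\<lambda>x. f' (m + x) - - f' (m - x) - 2 * f' m"
  have "norm (?g h - ?g 0) \<le> w * norm (h - 0)"
  proof (rule field_differentiable_bound)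
    show "(?g has_field_derivative ?g' x) (at x within {0..h})" if "x \<in> {0..h}" for x
      using DERIV_reflected[OF f that] by (intro DERIV_diff) (auto intro!: derivative_eq_intros)
    show "norm (?g' x) \<le> w" if "x \<in> {0..h}" for x
      using w[OF that] by simp
  qed (use \<open>0 \<le> h\<close> in auto)
  then show ?thesis using \<open>0 \<le> h\<close> by (simp add: mult.commute mult.left_commute)
qed

text \<open>
  Let \<open>h\<close> be half of the step. The mean value is off by at most \<open>h\<close> times the oscillation of the first
  derivative. The quadrature error is at most \<open>2 h\<close> times the oscillation of the first derivative or, if there is
  a second one, \<open>h\<^sup>2\<close> times the oscillation of that. These oscillations are bounded by \<open>\<mu>(a)\<close> for the highest
  derivative and by a multiple of \<open>a\<close> for the others. As \<open>h \<le> a\<close>, everything has the order claimed,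
  after division of the quadrature error by the step.
\<close>

lemma truncation_error:
  fixes D :: "nat \<Rightarrow> real \<Rightarrow> real"
  assumes "0 \<le> T" and k: "k \<in> {0, 1, 2}"
    and deriv: "\<And>i t. \<lbrakk>i \<le> k; t \<in> {0..T}\<rbrakk> \<Longrightarrow> (D i has_real_derivative D (Suc i) t) (at t within {0..T})"
    and cont: "\<And>i. i \<le> Suc k \<Longrightarrow> continuous_on {0..T} (D i)"
  obtains \<eta> :: "real \<Rightarrow> real" where "mono_on {0<..} \<eta>" "\<And>a. 0 < a \<Longrightarrow> 0 \<le> \<eta> a"
    "k \<in> {0, 1} \<Longrightarrow> \<eta> \<in> o[at_right 0](\<lambda>a. a ^ k)" "k = 2 \<Longrightarrow> \<eta> \<in> O[at_right 0](\<lambda>a. a ^ 2)"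
    "\<And>a s s'. \<lbrakk>0 \<le> s; s < s'; s' \<le> T; s' - s \<le> a\<rbrakk> \<Longrightarrow>
       \<bar>D 0 s' - D 0 s - (s' - s) * D 1 ((s + s') / 2)\<bar> \<le> (s' - s) * \<eta> a"
    "\<And>a s s'. \<lbrakk>0 \<le> s; s < s'; s' \<le> T; s' - s \<le> a\<rbrakk> \<Longrightarrow>
       \<bar>(D 0 s + D 0 s') / 2 - D 0 ((s + s') / 2)\<bar> \<le> \<eta> a"
proof -
  note conclude = that
  have "\<forall>i\<le>Suc k. \<exists>B. \<forall>t\<in>{0..T}. \<bar>D i t\<bar> \<le> B"
  proof (intro allI impI)
    fix i assume "i \<le> Suc k"
    then have "bounded (D i ` {0..T})"
      using cont by (intro compact_imp_bounded compact_continuous_image) auto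
    then show "\<exists>B. \<forall>t\<in>{0..T}. \<bar>D i t\<bar> \<le> B" by (auto simp: bounded_iff)
  qed
  then obtain B where B: "\<And>i t. i \<le> Suc k \<Longrightarrow> t \<in> {0..T} \<Longrightarrow> \<bar>D i t\<bar> \<le> B i"
    by metis
  have B0: "0 \<le> B i" if "i \<le> Suc k" for i
    using B[OF that, of 0] \<open>0 \<le> T\<close> by force
  have lip: "\<bar>D i x - D i y\<bar> \<le> B (Suc i) * \<bar>x - y\<bar>" if "i \<le> k" "x \<in> {0..T}" "y \<in> {0..T}" for i x y
    using field_differentiable_bound[of "{0..T}" "D i" "D (Suc i)" "B (Suc i)" x y] deriv B that by auto
  obtain \<mu> where \<mu>: "mono_on {0<..} \<mu>" "\<And>a. 0 < a \<Longrightarrow> 0 \<le> \<mu> a" "(\<mu> \<longlongrightarrow> 0) (at_right 0)"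
    "\<And>a s t. \<lbrakk>0 < a; s \<in> {0..T}; t \<in> {0..T}; \<bar>s - t\<bar> \<le> a\<rbrakk> \<Longrightarrow> \<bar>D (Suc k) s - D (Suc k) t\<bar> \<le> \<mu> a"
    using modulus_of_continuity[OF cont[of "Suc k"] \<open>0 \<le> T\<close>] by blast
  have sub: "(D i has_real_derivative D (Suc i) x) (at x within {p..q})" if "i \<le> k" "{p..q} \<subseteq> {0..T}" "x \<in> {p..q}" for i p q x
    using that by (intro DERIV_subset[OF deriv]) auto
  have avg: "\<bar>D 0 (m - h) + D 0 (m + h) - 2 * D 0 m\<bar> \<le> h * w"
    if "{m - h..m + h} \<subseteq> {0..T}" "0 \<le> h" "\<And>x y. x \<in> {m - h..m + h} \<Longrightarrow> y \<in> {m - h..m + h} \<Longrightarrow> \<bar>D 1 x - D 1 y\<bar> \<le> w" for m h w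
    using second_difference_le[of m h "D 0" "D 1" w] sub[of 0] that by (auto simp: add.commute)
  have quad: "\<bar>D 0 (m + h) - D 0 (m - h) - 2 * h * D 1 m\<bar> \<le> h * (h * w)"
    if k1: "1 \<le> k" and I: "{m - h..m + h} \<subseteq> {0..T}" and "0 \<le> h" "0 \<le> w" and osc: "\<And>x y. x \<in> {m - h..m + h} \<Longrightarrow> y \<in> {m - h..m + h} \<Longrightarrow> \<bar>D 2 x - D 2 y\<bar> \<le> w" for m h w
  proof (rule midpoint_rule_le)
    show "(D 0 has_real_derivative D 1 x) (at x within {m - h..m + h})" if "x \<in> {m - h..m + h}" for x
      using sub[of 0] that I by simp
    show "\<bar>D 1 (m + x) + D 1 (m - x) - 2 * D 1 m\<bar> \<le> h * w" if x: "x \<in> {0..h}" for x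
    proof -
      have "{m - x..m + x} \<subseteq> {m - h..m + h}" using x by auto
      moreover from this have "(D 1 has_real_derivative D 2 y) (at y within {m - x..m + x})" if "y \<in> {m - x..m + x}" for y
        using sub[OF k1 subset_trans[OF _ I] that] by (simp add: numeral_2_eq_2)
      ultimately have "\<bar>D 1 (m + x) + D 1 (m - x) - 2 * D 1 m\<bar> \<le> x * w"
        using osc x by (intro second_difference_le[where f' = "D 2"]) auto
      also have "\<dots> \<le> h * w" using x \<open>0 \<le> w\<close> by (intro mult_right_mono) auto
      finally show ?thesis .
    qed
  qed fact
  \<comment> \<open>the estimates in terms of the middle \<open>m\<close> and the half step \<open>h\<close>; the one for the mean value is doubled\<close>
  have reduce: thesis
    if \<eta>: "mono_on {0<..} \<eta>" "\<And>a. 0 < a \<Longrightarrow> 0 \<le> \<eta> a"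
      "k \<in> {0, 1} \<Longrightarrow> \<eta> \<in> o[at_right 0](\<lambda>a. a ^ k)" "k = 2 \<Longrightarrow> \<eta> \<in> O[at_right 0](\<lambda>a. a ^ 2)"
      and mid: "\<And>a m h. \<lbrakk>{m - h..m + h} \<subseteq> {0..T}; 0 < h; h \<le> T; 2 * h \<le> a\<rbrakk> \<Longrightarrow>
         \<bar>D 0 (m + h) - D 0 (m - h) - 2 * h * D 1 m\<bar> \<le> 2 * h * \<eta> a \<and>
         \<bar>D 0 (m - h) + D 0 (m + h) - 2 * D 0 m\<bar> \<le> 2 * \<eta> a" for \<eta>
  proof (rule conclude)
    fix a s s' :: real
    assume s: "0 \<le> s" "s < s'" "s' \<le> T" "s' - s \<le> a"
    define m h where "m = (s + s') / 2" and "h = (s' - s) / 2"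
    have mh: "m - h = s" "m + h = s'" "2 * h = s' - s" by (auto simp: m_def h_def field_simps)
    have "h \<le> T" "0 < h" using s by (auto simp: h_def)
    then have *: "\<bar>D 0 s' - D 0 s - (s' - s) * D 1 m\<bar> \<le> (s' - s) * \<eta> a \<and> \<bar>D 0 s + D 0 s' - 2 * D 0 m\<bar> \<le> 2 * \<eta> a"
      using mid[of m h a] s unfolding mh by auto
    then show "\<bar>D 0 s' - D 0 s - (s' - s) * D 1 ((s + s') / 2)\<bar> \<le> (s' - s) * \<eta> a"
      by (simp add: m_def)
    have eq: "(D 0 s + D 0 s') / 2 - D 0 m = (D 0 s + D 0 s' - 2 * D 0 m) / 2" by (simp add: field_simps)
    show "\<bar>(D 0 s + D 0 s') / 2 - D 0 ((s + s') / 2)\<bar> \<le> \<eta> a"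
      unfolding m_def[symmetric] eq abs_divide using * by simp
  qed (use \<eta> in auto)
  consider "k = 0" | "k = 1" | "k = 2" using k by auto
  then show thesis
  proof cases
    case 1
    show thesis
    \<comment> \<open>the mean value is off by \<open>h \<mu>(a)\<close>, and \<open>h \<le> T\<close> makes this a multiple of \<open>\<mu>(a)\<close>\<close>
    proof (rule reduce[of "\<lambda>a. (1 + T) * \<mu> a"])
      show "mono_on {0<..} (\<lambda>a. (1 + T) * \<mu> a)"
        using \<mu>(1) \<open>0 \<le> T\<close> by (auto simp: mono_on_def intro!: mult_left_mono)
      have "((\<lambda>a. (1 + T) * \<mu> a) \<longlongrightarrow> (1 + T) * 0) (at_right 0)"
        by (intro tendsto_intros \<mu>)
      then show "(\<lambda>a. (1 + T) * \<mu> a) \<in> o[at_right 0](\<lambda>a. a ^ k)"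
        by (intro smalloI_tendsto) (auto simp: 1)
      fix a m h assume I: "{m - h..m + h} \<subseteq> {0..T}" "0 < h" "h \<le> T" "2 * h \<le> a"
      have osc: "\<bar>D 1 x - D 1 y\<bar> \<le> \<mu> a" if "x \<in> {m - h..m + h}" "y \<in> {m - h..m + h}" for x y
        using \<mu>(4)[of a x y] that I 1 by auto
      have pos: "0 \<le> \<mu> a" using \<mu>(2) I by simp
      have "\<bar>D 0 (m + h) - D 0 (m - h) - 2 * h * D 1 m\<bar> \<le> h * (2 * \<mu> a)"
      proof (rule midpoint_rule_le)
        show "\<bar>D 1 (m + x) + D 1 (m - x) - 2 * D 1 m\<bar> \<le> 2 * \<mu> a" if "x \<in> {0..h}" for x
          using osc[of "m + x" m] osc[of "m - x" m] that I(2) by auto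
      qed (use sub[of 0] I in auto)
      also have "\<dots> \<le> 2 * h * ((1 + T) * \<mu> a)"
        using pos \<open>0 \<le> T\<close> I(2) by (simp add: algebra_simps)
      finally have "\<bar>D 0 (m + h) - D 0 (m - h) - 2 * h * D 1 m\<bar> \<le> 2 * h * ((1 + T) * \<mu> a)" .
      moreover have "\<bar>D 0 (m - h) + D 0 (m + h) - 2 * D 0 m\<bar> \<le> 2 * ((1 + T) * \<mu> a)"
      proof -
        have "\<bar>D 0 (m - h) + D 0 (m + h) - 2 * D 0 m\<bar> \<le> h * \<mu> a"
          using osc I by (intro avg) auto
        also have "\<dots> \<le> T * \<mu> a" using pos I(3) by (intro mult_right_mono)
        also have "\<dots> \<le> 2 * ((1 + T) * \<mu> a)" using pos \<open>0 \<le> T\<close> by (simp add: algebra_simps)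
        finally show ?thesis .
      qed
      ultimately show "\<bar>D 0 (m + h) - D 0 (m - h) - 2 * h * D 1 m\<bar> \<le> 2 * h * ((1 + T) * \<mu> a) \<and>
         \<bar>D 0 (m - h) + D 0 (m + h) - 2 * D 0 m\<bar> \<le> 2 * ((1 + T) * \<mu> a)" by blast
    qed (use \<mu>(2) \<open>0 \<le> T\<close> 1 in auto)
  next
    case 2
    have B2: "0 \<le> B 2" using B0[of 2] 2 by simp
    show thesis
    \<comment> \<open>\<open>h \<mu>(a)\<close> from the quadrature and \<open>h B\<^sub>2 a\<close> from the mean value, where \<open>h \<le> a\<close>\<close>
    proof (rule reduce[of "\<lambda>a. a * \<mu> a + B 2 * a^2"])
      show "mono_on {0<..} (\<lambda>a. a * \<mu> a + B 2 * a^2)"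
        using \<mu>(1,2) B2 by (auto simp: mono_on_def intro!: add_mono mult_mono power_mono)
      have "((\<lambda>a. \<mu> a + B 2 * a) \<longlongrightarrow> 0 + B 2 * 0) (at_right 0)"
        by (intro tendsto_intros \<mu>)
      then have "((\<lambda>a. \<mu> a + B 2 * a) \<longlongrightarrow> 0) (at_right 0)" by simp
      moreover have "\<forall>\<^sub>F a in at_right 0. \<mu> a + B 2 * a = (a * \<mu> a + B 2 * a^2) / a ^ k"
        by (intro eventually_at_rightI[of 0 1]) (auto simp: 2 field_simps power2_eq_square)
      ultimately have "((\<lambda>a. (a * \<mu> a + B 2 * a^2) / a ^ k) \<longlongrightarrow> 0) (at_right 0)"
        by (rule Lim_transform_eventually)
      then show "(\<lambda>a. a * \<mu> a + B 2 * a^2) \<in> o[at_right 0](\<lambda>a. a ^ k)"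
        by (intro smalloI_tendsto) (auto simp: 2 eventually_at_filter)
      fix a m h assume I: "{m - h..m + h} \<subseteq> {0..T}" "0 < h" "h \<le> T" "2 * h \<le> a"
      have pos: "0 \<le> \<mu> a" using \<mu>(2) I by simp
      have osc2: "\<bar>D 2 x - D 2 y\<bar> \<le> \<mu> a" if "x \<in> {m - h..m + h}" "y \<in> {m - h..m + h}" for x y
        using \<mu>(4)[of a x y] that I 2 by (auto simp: numeral_2_eq_2)
      have osc1: "\<bar>D 1 x - D 1 y\<bar> \<le> B 2 * a" if "x \<in> {m - h..m + h}" "y \<in> {m - h..m + h}" for x y
      proof -
        have "\<bar>D 1 x - D 1 y\<bar> \<le> B 2 * \<bar>x - y\<bar>"
          using lip[of 1 x y] that I 2 by (auto simp: numeral_2_eq_2)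
        also have "\<dots> \<le> B 2 * a" using that I B2 by (intro mult_left_mono) auto
        finally show ?thesis .
      qed
      have "\<bar>D 0 (m + h) - D 0 (m - h) - 2 * h * D 1 m\<bar> \<le> h * (h * \<mu> a)"
        using I pos osc2 2 by (intro quad) auto
      also have "\<dots> \<le> (2 * h) * (a * \<mu> a + B 2 * a^2)"
        using I pos B2 by (intro mult_mono add_increasing2) auto
      finally have "\<bar>D 0 (m + h) - D 0 (m - h) - 2 * h * D 1 m\<bar> \<le> 2 * h * (a * \<mu> a + B 2 * a^2)" .
      moreover have "\<bar>D 0 (m - h) + D 0 (m + h) - 2 * D 0 m\<bar> \<le> 2 * (a * \<mu> a + B 2 * a^2)"
      proof -
        have "\<bar>D 0 (m - h) + D 0 (m + h) - 2 * D 0 m\<bar> \<le> h * (B 2 * a)"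
          using osc1 I by (intro avg) auto
        also have "\<dots> \<le> a * (B 2 * a)" using B2 I by (intro mult_right_mono) auto
        also have "\<dots> \<le> 2 * (a * \<mu> a + B 2 * a^2)" using pos B2 I by (simp add: power2_eq_square algebra_simps)
        finally show ?thesis .
      qed
      ultimately show "\<bar>D 0 (m + h) - D 0 (m - h) - 2 * h * D 1 m\<bar> \<le> 2 * h * (a * \<mu> a + B 2 * a^2) \<and>
         \<bar>D 0 (m - h) + D 0 (m + h) - 2 * D 0 m\<bar> \<le> 2 * (a * \<mu> a + B 2 * a^2)" by blast
    qed (use \<mu>(2) B2 2 in auto)
  next
    case 3
    have B2: "0 \<le> B 2" "0 \<le> B 3" using B0[of 2] B0[of 3] 3 by simp_all
    show thesis
    \<comment> \<open>\<open>h B\<^sub>3 a\<close> from the quadrature and \<open>h B\<^sub>2 a\<close> from the mean value, where \<open>h \<le> a\<close>\<close>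
    proof (rule reduce[of "\<lambda>a. (B 2 + B 3) * a^2"])
      show "mono_on {0<..} (\<lambda>a. (B 2 + B 3) * a^2)"
        using B2 by (auto simp: mono_on_def intro!: mult_left_mono power_mono)
      show "(\<lambda>a. (B 2 + B 3) * a^2) \<in> O[at_right 0](\<lambda>a. a ^ 2)"
        by simp
      fix a m h assume I: "{m - h..m + h} \<subseteq> {0..T}" "0 < h" "h \<le> T" "2 * h \<le> a"
      have osc: "\<bar>D i x - D i y\<bar> \<le> B (Suc i) * a" if "x \<in> {m - h..m + h}" "y \<in> {m - h..m + h}" "i \<in> {1, 2}" for i x y
      proof -
        have "\<bar>D i x - D i y\<bar> \<le> B (Suc i) * \<bar>x - y\<bar>"
          using lip[of i x y] that I 3 by auto
        also have "\<dots> \<le> B (Suc i) * a" using that I B0[of "Suc i"] 3 by (intro mult_left_mono) auto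
        finally show ?thesis .
      qed
      have "\<bar>D 0 (m + h) - D 0 (m - h) - 2 * h * D 1 m\<bar> \<le> h * (h * (B 3 * a))"
        using I osc[of _ _ 2] 3 B2 by (intro quad) auto
      also have "\<dots> \<le> (2 * h) * (a * (B 3 * a))"
        using I B2 by (intro mult_mono) auto
      also have "\<dots> \<le> (2 * h) * ((B 2 + B 3) * a^2)"
        using I B2 by (intro mult_left_mono) (auto simp: power2_eq_square algebra_simps)
      finally have "\<bar>D 0 (m + h) - D 0 (m - h) - 2 * h * D 1 m\<bar> \<le> 2 * h * ((B 2 + B 3) * a^2)" .
      moreover have "\<bar>D 0 (m - h) + D 0 (m + h) - 2 * D 0 m\<bar> \<le> 2 * ((B 2 + B 3) * a^2)"
      proof -
        have "\<bar>D 0 (m - h) + D 0 (m + h) - 2 * D 0 m\<bar> \<le> h * (B 2 * a)"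
          using osc[of _ _ 1] I by (intro avg) (auto simp: numeral_2_eq_2)
        also have "\<dots> \<le> a * (B 2 * a)" using B2 I by (intro mult_right_mono) auto
        also have "\<dots> \<le> 2 * ((B 2 + B 3) * a^2)" using B2 I by (simp add: power2_eq_square algebra_simps)
        finally show ?thesis .
      qed
      ultimately show "\<bar>D 0 (m + h) - D 0 (m - h) - 2 * h * D 1 m\<bar> \<le> 2 * h * ((B 2 + B 3) * a^2) \<and>
         \<bar>D 0 (m - h) + D 0 (m + h) - 2 * D 0 m\<bar> \<le> 2 * ((B 2 + B 3) * a^2)" by blast
    qed (use B2 3 in auto)
  qed
qed

text \<open>
  The normals are constant along the motion, so heights are fixed linear functionals of the vertices and
  inherit their smoothness.
\<close>

lemma motion_heights:
  assumes "0 < T" and motion: "polygonal_motion P k {0..T} \<Gamma>" and k: "1 \<le> k" and j: "j \<in> {1..length P}"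
  obtains D where "\<And>t. t \<in> {0..T} \<Longrightarrow> D 0 t = height (\<Gamma> t) j"
    "\<And>t. t \<in> {0..T} \<Longrightarrow> D 1 t = normal_velocity {0..T} \<Gamma> j t"
    "\<And>i t. \<lbrakk>i < k; t \<in> {0..T}\<rbrakk> \<Longrightarrow> (D i has_real_derivative D (Suc i) t) (at t within {0..T})"
    "\<And>i. i \<le> k \<Longrightarrow> continuous_on {0..T} (D i)"
proof -
  let ?n = "edge_normal P j"
  have "Ck_on k {0..T} (\<lambda>t. vertex (\<Gamma> t) j)"
    using motion j by (simp add: polygonal_motion_def)
  then obtain V where V0: "V 0 = (\<lambda>t. vertex (\<Gamma> t) j)"
    and V1: "\<forall>i<k. \<forall>t\<in>{0..T}. (V i has_vector_derivative V (Suc i) t) (at t within {0..T})"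
    and V2: "\<forall>i\<le>k. continuous_on {0..T} (V i)"
    unfolding Ck_on_def by blast
  have V: "(V i has_vector_derivative V (Suc i) t) (at t within {0..T})" if "i < k" "t \<in> {0..T}" for i t
    using V1 that by blast
  define D where "D i t = V i t \<bullet> ?n" for i t
  have deriv: "(D i has_real_derivative D (Suc i) t) (at t within {0..T})" if "i < k" "t \<in> {0..T}" for i t
    unfolding has_real_derivative_iff_has_vector_derivative D_def
    using bounded_linear.has_vector_derivative[OF bounded_linear_inner_left V[OF that]] .
  have D0: "D 0 t = height (\<Gamma> t) j" if "t \<in> {0..T}" for t
    using motion that j by (simp add: D_def V0 height_def polygonal_motion_def poly_class_def)
  have D1: "D 1 t = normal_velocity {0..T} \<Gamma> j t" if t: "t \<in> {0..T}" for t
  proof -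
    have "((\<lambda>t. height (\<Gamma> t) j) has_vector_derivative D 1 t) (at t within {0..T})"
      using deriv[of 0 t] t k D0
      by (intro has_vector_derivative_transform[of t "{0..T}" "\<lambda>t. height (\<Gamma> t) j" "D 0"])
         (auto simp: has_real_derivative_iff_has_vector_derivative)
    then show ?thesis
      unfolding normal_velocity_def
      using vector_derivative_within_cbox[of 0 T t "\<lambda>t. height (\<Gamma> t) j"] \<open>0 < T\<close> t by simp
  qed
  show thesis
  proof (rule that[OF D0 D1 deriv])
    show "continuous_on {0..T} (D i)" if "i \<le> k" for i
      unfolding D_def using V2 that by (intro continuous_intros) blast
  qed auto
qed

text \<open>
  The velocity law turns the first derivatives of the heights into values of \<open>F\<close> along the motion. Summing
  over the edges makes the bounds uniform in the edge and keeps monotonicity and orders.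
\<close>

lemma motion_truncation_error:
  assumes T: "0 < T" and k: "k \<in> {0, 1, 2}" and motion: "polygonal_motion P (k + 1) {0..T} \<Gamma>"
    and velocity: "\<forall>t\<in>{0..T}. \<forall>j\<in>{1..length P}. normal_velocity {0..T} \<Gamma> j t = F (\<Gamma> t) t j"
  obtains \<eta> :: "real \<Rightarrow> real" and B where "mono_on {0<..} \<eta>" "\<And>a. 0 < a \<Longrightarrow> 0 \<le> \<eta> a"
    "k \<in> {0, 1} \<Longrightarrow> \<eta> \<in> o[at_right 0](\<lambda>a. a ^ k)" "k = 2 \<Longrightarrow> \<eta> \<in> O[at_right 0](\<lambda>a. a ^ 2)"
    "\<And>t j. \<lbrakk>t \<in> {0..T}; j \<in> {1..length P}\<rbrakk> \<Longrightarrow> \<bar>F (\<Gamma> t) t j\<bar> \<le> B"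
    "\<And>s t j. \<lbrakk>s \<in> {0..T}; t \<in> {0..T}; j \<in> {1..length P}\<rbrakk> \<Longrightarrow> \<bar>height (\<Gamma> s) j - height (\<Gamma> t) j\<bar> \<le> B * \<bar>s - t\<bar>"
    "\<And>a s s' j. \<lbrakk>0 \<le> s; s < s'; s' \<le> T; s' - s \<le> a; j \<in> {1..length P}\<rbrakk> \<Longrightarrow>
       \<bar>height (\<Gamma> s') j - height (\<Gamma> s) j - (s' - s) * F (\<Gamma> ((s + s') / 2)) ((s + s') / 2) j\<bar> \<le> (s' - s) * \<eta> a"
    "\<And>a s s' j. \<lbrakk>0 \<le> s; s < s'; s' \<le> T; s' - s \<le> a; j \<in> {1..length P}\<rbrakk> \<Longrightarrow>
       \<bar>(height (\<Gamma> s) j + height (\<Gamma> s') j) / 2 - height (\<Gamma> ((s + s') / 2)) j\<bar> \<le> \<eta> a"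
proof -
  define I where "I = {1..length P}"
  define good where "good j \<eta> B \<longleftrightarrow> mono_on {0<..} \<eta> \<and> (\<forall>a>0. 0 \<le> \<eta> a) \<and>
     (k \<in> {0, 1} \<longrightarrow> \<eta> \<in> o[at_right 0](\<lambda>a. a ^ k)) \<and> (k = 2 \<longrightarrow> \<eta> \<in> O[at_right 0](\<lambda>a. a ^ 2)) \<and>
     (\<forall>t\<in>{0..T}. \<bar>F (\<Gamma> t) t j\<bar> \<le> B) \<and>
     (\<forall>s\<in>{0..T}. \<forall>t\<in>{0..T}. \<bar>height (\<Gamma> s) j - height (\<Gamma> t) j\<bar> \<le> B * \<bar>s - t\<bar>) \<and>
     (\<forall>a s s'. 0 \<le> s \<and> s < s' \<and> s' \<le> T \<and> s' - s \<le> a \<longrightarrow>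
       \<bar>height (\<Gamma> s') j - height (\<Gamma> s) j - (s' - s) * F (\<Gamma> ((s + s') / 2)) ((s + s') / 2) j\<bar> \<le> (s' - s) * \<eta> a \<and>
       \<bar>(height (\<Gamma> s) j + height (\<Gamma> s') j) / 2 - height (\<Gamma> ((s + s') / 2)) j\<bar> \<le> \<eta> a)" for j and \<eta> :: "real \<Rightarrow> real" and B :: real
  have "\<exists>\<eta> B. good j \<eta> B" if j: "j \<in> I" for j
  proof -
    obtain D where D0: "\<And>t. t \<in> {0..T} \<Longrightarrow> D 0 t = height (\<Gamma> t) j"
      and D1: "\<And>t. t \<in> {0..T} \<Longrightarrow> D 1 t = normal_velocity {0..T} \<Gamma> j t"
      and deriv: "\<And>i t. \<lbrakk>i < k + 1; t \<in> {0..T}\<rbrakk> \<Longrightarrow> (D i has_real_derivative D (Suc i) t) (at t within {0..T})"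
      and cont: "\<And>i. i \<le> k + 1 \<Longrightarrow> continuous_on {0..T} (D i)"
      using motion_heights[OF T motion _ j[unfolded I_def]] by (metis le_add2)
    have D1': "D 1 t = F (\<Gamma> t) t j" if "t \<in> {0..T}" for t
      using D1[OF that] velocity that j by (simp add: I_def)
    have "bounded (D 1 ` {0..T})"
      using cont[of 1] by (intro compact_imp_bounded compact_continuous_image) auto
    then obtain B where B: "\<And>t. t \<in> {0..T} \<Longrightarrow> \<bar>D 1 t\<bar> \<le> B"
      unfolding bounded_iff by (metis imageI real_norm_def)
    have lip: "\<bar>D 0 s - D 0 t\<bar> \<le> B * \<bar>s - t\<bar>" if "s \<in> {0..T}" "t \<in> {0..T}" for s t
      using field_differentiable_bound[of "{0..T}" "D 0" "D 1" B s t] deriv[of 0] B that by auto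
    have deriv': "(D i has_real_derivative D (Suc i) t) (at t within {0..T})" if "i \<le> k" "t \<in> {0..T}" for i t
      using deriv that by simp
    have cont': "continuous_on {0..T} (D i)" if "i \<le> Suc k" for i
      using cont that by simp
    obtain \<eta> :: "real \<Rightarrow> real" where \<eta>: "mono_on {0<..} \<eta>" "\<And>a. 0 < a \<Longrightarrow> 0 \<le> \<eta> a"
      "k \<in> {0, 1} \<Longrightarrow> \<eta> \<in> o[at_right 0](\<lambda>a. a ^ k)" "k = 2 \<Longrightarrow> \<eta> \<in> O[at_right 0](\<lambda>a. a ^ 2)"
      and trunc: "\<And>a s s'. \<lbrakk>0 \<le> s; s < s'; s' \<le> T; s' - s \<le> a\<rbrakk> \<Longrightarrow>
         \<bar>D 0 s' - D 0 s - (s' - s) * D 1 ((s + s') / 2)\<bar> \<le> (s' - s) * \<eta> a"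
      and average: "\<And>a s s'. \<lbrakk>0 \<le> s; s < s'; s' \<le> T; s' - s \<le> a\<rbrakk> \<Longrightarrow>
         \<bar>(D 0 s + D 0 s') / 2 - D 0 ((s + s') / 2)\<bar> \<le> \<eta> a"
      using truncation_error[where D = D, OF less_imp_le[OF T] k deriv' cont'] by blast
    have "good j \<eta> B"
      unfolding good_def
    proof (intro conjI ballI allI impI)
      fix a s s' assume "0 \<le> s \<and> s < s' \<and> s' \<le> T \<and> s' - s \<le> a"
      then have s: "0 \<le> s" "s < s'" "s' \<le> T" "s' - s \<le> a" by auto
      then have "s \<in> {0..T}" "s' \<in> {0..T}" "(s + s') / 2 \<in> {0..T}" by auto
      then show "\<bar>height (\<Gamma> s') j - height (\<Gamma> s) j - (s' - s) * F (\<Gamma> ((s + s') / 2)) ((s + s') / 2) j\<bar> \<le> (s' - s) * \<eta> a"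
        "\<bar>(height (\<Gamma> s) j + height (\<Gamma> s') j) / 2 - height (\<Gamma> ((s + s') / 2)) j\<bar> \<le> \<eta> a"
        using trunc[OF s] average[OF s] by (simp_all only: D0 D1')
    next
      show "\<bar>F (\<Gamma> t) t j\<bar> \<le> B" if "t \<in> {0..T}" for t using B[OF that] D1'[OF that] by simp
      show "\<bar>height (\<Gamma> s) j - height (\<Gamma> t) j\<bar> \<le> B * \<bar>s - t\<bar>" if "s \<in> {0..T}" "t \<in> {0..T}" for s t
        using lip[OF that] that by (simp only: D0)
    qed (use \<eta> in auto)
    then show ?thesis by blast
  qed
  then have "\<exists>p. good j (fst p) (snd p)" if "j \<in> I" for j using that by auto
  then obtain p where p: "\<And>j. j \<in> I \<Longrightarrow> good j (fst (p j)) (snd (p j))" by metis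
  define \<eta> where "\<eta> a = (\<Sum>j\<in>I. fst (p j) a)" for a
  define B where "B = (\<Sum>j\<in>I. \<bar>snd (p j)\<bar>)"
  have \<eta>_ge: "fst (p j) a \<le> \<eta> a" if "j \<in> I" "0 < a" for j a
    unfolding \<eta>_def using p that by (intro member_le_sum) (auto simp: good_def I_def)
  have B_ge: "snd (p j) \<le> B" if "j \<in> I" for j
  proof -
    have "\<bar>snd (p j)\<bar> \<le> B" unfolding B_def using that by (intro member_le_sum) (auto simp: I_def)
    then show ?thesis by simp
  qed
  show thesis
  proof (rule that[of \<eta> B])
    show "mono_on {0<..} \<eta>"
      using p unfolding good_def mono_on_def \<eta>_def by (auto intro!: sum_mono)
    show "0 \<le> \<eta> a" if "0 < a" for a
      using p that unfolding good_def \<eta>_def by (auto intro!: sum_nonneg)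
    show "\<eta> \<in> o[at_right 0](\<lambda>a. a ^ k)" if "k \<in> {0, 1}"
      using p that unfolding good_def \<eta>_def by (intro big_sum_in_smallo) blast
    show "\<eta> \<in> O[at_right 0](\<lambda>a. a ^ 2)" if "k = 2"
      using p that unfolding good_def \<eta>_def by (intro big_sum_in_bigo) blast
    show "\<bar>F (\<Gamma> t) t j\<bar> \<le> B" if "t \<in> {0..T}" "j \<in> {1..length P}" for t j
    proof -
      have "good j (fst (p j)) (snd (p j))" "snd (p j) \<le> B" using p B_ge that(2) by (auto simp: I_def)
      then show ?thesis using that(1) unfolding good_def by (meson order_trans)
    qed
    show "\<bar>height (\<Gamma> s) j - height (\<Gamma> t) j\<bar> \<le> B * \<bar>s - t\<bar>"
      if "s \<in> {0..T}" "t \<in> {0..T}" "j \<in> {1..length P}" for s t j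
    proof -
      have "\<bar>height (\<Gamma> s) j - height (\<Gamma> t) j\<bar> \<le> snd (p j) * \<bar>s - t\<bar>"
        using p[of j] that unfolding good_def I_def by blast
      also have "\<dots> \<le> B * \<bar>s - t\<bar>" using B_ge[of j] that by (intro mult_right_mono) (auto simp: I_def)
      finally show ?thesis .
    qed
    fix a s s' j assume s: "0 \<le> s" "s < s'" "s' \<le> T" "s' - s \<le> a" and j: "j \<in> {1..length P}"
    have ge: "fst (p j) a \<le> \<eta> a" using \<eta>_ge[of j a] s j by (simp add: I_def)
    have "\<bar>height (\<Gamma> s') j - height (\<Gamma> s) j - (s' - s) * F (\<Gamma> ((s + s') / 2)) ((s + s') / 2) j\<bar> \<le> (s' - s) * fst (p j) a"
      using p[of j] s j unfolding good_def I_def by blast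
    also have "\<dots> \<le> (s' - s) * \<eta> a" using ge s by (intro mult_left_mono) auto
    finally show "\<bar>height (\<Gamma> s') j - height (\<Gamma> s) j - (s' - s) * F (\<Gamma> ((s + s') / 2)) ((s + s') / 2) j\<bar> \<le> (s' - s) * \<eta> a" .
    have "\<bar>(height (\<Gamma> s) j + height (\<Gamma> s') j) / 2 - height (\<Gamma> ((s + s') / 2)) j\<bar> \<le> fst (p j) a"
      using p[of j] s j unfolding good_def I_def by blast
    with ge show "\<bar>(height (\<Gamma> s) j + height (\<Gamma> s') j) / 2 - height (\<Gamma> ((s + s') / 2)) j\<bar> \<le> \<eta> a" by linarith
  qed
qed

section \<open>Propagation of the error\<close>

text \<open>
  Solving for \<open>e'\<close> costs the factor \<open>(1 + x/2) / (1 - x/2)\<close> with \<open>x = h L\<close>, which is at most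
  \<open>1 + 2 x\<close> if \<open>x \<le> 1\<close>.
\<close>

lemma implicit_gronwall_step:
  fixes e e' :: real
  assumes "0 \<le> e" "0 \<le> h" "0 \<le> L" "0 \<le> b" "h * L \<le> 1"
    and le: "e' \<le> e + h * (L * ((e + e') / 2) + b)"
  shows "e' \<le> exp (2 * L * h) * (e + h * b)"
proof -
  define x where "x = h * L"
  have x: "0 \<le> x" "x \<le> 1" using assms by (auto simp: x_def)
  have hb: "0 \<le> h * b" using assms by simp
  have "(1 - x / 2) * e' \<le> (1 + x / 2) * e + h * b"
    using le by (simp add: x_def algebra_simps add_divide_distrib)
  also have "\<dots> \<le> (1 + x / 2) * (e + h * b)"
    using mult_nonneg_nonneg[OF hb x(1)] by (simp add: algebra_simps)
  also have "\<dots> \<le> ((1 - x / 2) * (1 + 2 * x)) * (e + h * b)"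
  proof (rule mult_right_mono)
    have "x * x \<le> x" using x by (simp add: mult_left_le)
    then show "1 + x / 2 \<le> (1 - x / 2) * (1 + 2 * x)" by (simp add: algebra_simps)
  qed (use hb assms in auto)
  finally have "(1 - x / 2) * e' \<le> (1 - x / 2) * ((1 + 2 * x) * (e + h * b))"
    by (simp add: mult.assoc)
  then have "e' \<le> (1 + 2 * x) * (e + h * b)"
    using x by (simp add: mult_le_cancel_left)
  also have "\<dots> \<le> exp (2 * x) * (e + h * b)"
    using hb assms exp_ge_add_one_self[of "2 * x"] by (intro mult_right_mono) auto
  finally show ?thesis by (simp add: x_def mult_ac)
qed

text \<open>
  The radius \<open>r\<close> of the tube is shared out as follows. Errors are kept below \<open>r/4\<close>, midpoints within
  \<open>r/4\<close> of the current polygon (so \<open>\<rho> = r/2\<close>), and during one step the exact solution moves by at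
  most \<open>r/2\<close>; hence each midpoint lies in the tube at the middle time, where the Lipschitz condition
  compares \<open>F\<close> there with the exact velocity. Existence of the next polygon and the bound for its error
  are proved by a joint induction.
\<close>

lemma implicit_scheme_converges:
  fixes \<Gamma> :: "real \<Rightarrow> complex list" and \<eta> :: "real \<Rightarrow> real"
  assumes poly: "is_polygon P" and U: "openin (poly_topology P) U" and T: "0 < T" "ereal T < Tstar"
    and lipschitz: "locally_lipschitz_field P U Tstar F"
    and \<Gamma>: "\<And>t. t \<in> {0..T} \<Longrightarrow> \<Gamma> t \<in> U"
    and speed: "\<And>t j. \<lbrakk>t \<in> {0..T}; j \<in> {1..length P}\<rbrakk> \<Longrightarrow> \<bar>F (\<Gamma> t) t j\<bar> \<le> B"
    and Lip\<Gamma>: "\<And>s t j. \<lbrakk>s \<in> {0..T}; t \<in> {0..T}; j \<in> {1..length P}\<rbrakk> \<Longrightarrow> \<bar>height (\<Gamma> s) j - height (\<Gamma> t) j\<bar> \<le> B * \<bar>s - t\<bar>"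
    and mono: "mono_on {0<..} \<eta>" and \<eta>_nonneg: "\<And>a. 0 < a \<Longrightarrow> 0 \<le> \<eta> a" and lim: "(\<eta> \<longlongrightarrow> 0) (at_right 0)"
    and trunc: "\<And>a s s' j. \<lbrakk>0 \<le> s; s < s'; s' \<le> T; s' - s \<le> a; j \<in> {1..length P}\<rbrakk> \<Longrightarrow>
       \<bar>height (\<Gamma> s') j - height (\<Gamma> s) j - (s' - s) * F (\<Gamma> ((s + s') / 2)) ((s + s') / 2) j\<bar> \<le> (s' - s) * \<eta> a"
    and average: "\<And>a s s' j. \<lbrakk>0 \<le> s; s < s'; s' \<le> T; s' - s \<le> a; j \<in> {1..length P}\<rbrakk> \<Longrightarrow>
       \<bar>(height (\<Gamma> s) j + height (\<Gamma> s') j) / 2 - height (\<Gamma> ((s + s') / 2)) j\<bar> \<le> \<eta> a"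
  obtains \<delta>star \<tau>star C C' \<rho> :: real
  where "0 < \<delta>star" "0 < \<tau>star" "0 < C" "0 < C'" "0 < \<rho>"
    "\<And>(mbar :: nat) (t :: nat \<Rightarrow> real) (\<tau> :: real) \<Gamma>0.
       \<lbrakk>1 \<le> mbar; t 0 = 0; \<forall>m<mbar. t m < t (Suc m); t mbar \<le> T;
        \<tau> = Max ((\<lambda>m. t (Suc m) - t m) ` {..<mbar}); \<tau> \<le> \<tau>star;
        \<Gamma>0 \<in> U; poly_dist (length P) (\<Gamma> 0) \<Gamma>0 \<le> \<delta>star\<rbrakk> \<Longrightarrow>
       \<exists>G :: nat \<Rightarrow> complex list.
          G 0 = \<Gamma>0 \<and>
          (\<forall>m\<in>{1..mbar}. G m \<in> U) \<and>
          (\<forall>m<mbar.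
             scheme_step P U F (t m) (t (Suc m)) (G m) (G (Suc m)) \<and>
             poly_dist (length P) (G m) (G (Suc m)) \<le> \<rho> \<and>
             (\<forall>\<Sigma>\<in>U. scheme_step P U F (t m) (t (Suc m)) (G m) \<Sigma> \<and>
                poly_dist (length P) (G m) \<Sigma> \<le> \<rho> \<longrightarrow> \<Sigma> = G (Suc m))) \<and>
          Max ((\<lambda>m. poly_dist (length P) (\<Gamma> (t m)) (G m)) ` {..mbar})
            \<le> C' * \<eta> \<tau> + C * poly_dist (length P) (\<Gamma> 0) \<Gamma>0"
proof -
  define N where "N = length P"
  define I where "I = {1..N}"
  note fold = N_def[symmetric] I_def[symmetric]
  have N1: "1 \<le> N" using is_polygon_length[OF poly] by (simp add: N_def)
  have le_iff: "poly_dist N X Y \<le> b \<longleftrightarrow> (\<forall>j\<in>I. \<bar>height X j - height Y j\<bar> \<le> b)" for X Y b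
    using poly_dist_le_iff[OF N1] by (simp add: I_def)
  have le_dist: "\<bar>height X j - height Y j\<bar> \<le> poly_dist N X Y" if "j \<in> I" for X Y j
    using height_diff_le_poly_dist that by (simp add: I_def)
  note speed = speed[unfolded fold] and Lip\<Gamma> = Lip\<Gamma>[unfolded fold] and trunc = trunc[unfolded fold] and average = average[unfolded fold]
  have sub: "U \<subseteq> poly_class P"
    using openin_subset[OF U] Metric_space.topspace_mtopology[OF Metric_space_poly_class[OF poly]]
    by (simp add: poly_topology_def)
  interpret Metric_space "poly_class P" "poly_dist N"
    unfolding N_def by (rule Metric_space_poly_class[OF poly])
  have B0: "0 \<le> B"
    using speed[of 0 1] T(1) N1 by (force simp: I_def)
  have cont: "continuous_on {0..T} (\<lambda>t. height (\<Gamma> t) j)" if "j \<in> {1..length P}" for j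
  proof (rule lipschitz_on_continuous_on[of B], rule lipschitz_onI)
    show "dist (height (\<Gamma> x) j) (height (\<Gamma> y) j) \<le> B * dist x y" if "x \<in> {0..T}" "y \<in> {0..T}" for x y
      using Lip\<Gamma>[OF that, of j] \<open>j \<in> {1..length P}\<close> by (simp add: dist_real_def I_def N_def)
  qed fact
  obtain K r where K: "compactin (poly_topology P) K" "K \<subseteq> U" and r: "0 < r"
    and real: "\<And>t g. t \<in> {0..T} \<Longrightarrow> \<forall>j\<in>I. \<bar>g j - height (\<Gamma> t) j\<bar> \<le> r \<Longrightarrow> \<exists>\<Sigma>\<in>K. \<forall>j\<in>I. height \<Sigma> j = g j"
    using compact_tube[OF poly U less_imp_le[OF T(1)] \<Gamma> cont] unfolding fold by metis
  have inK: "M \<in> K" if "M \<in> U" and t: "t \<in> {0..T}" and near: "poly_dist N (\<Gamma> t) M \<le> r" for M t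
  proof -
    obtain M' where M': "M' \<in> K" "\<forall>j\<in>I. height M' j = height M j"
      using real[OF t, of "height M"] near unfolding le_iff by (auto simp: abs_minus_commute)
    have "M' = M"
      using M' \<open>M \<in> U\<close> K(2) sub by (intro heights_determine_polygon) (auto simp: I_def N_def)
    then show ?thesis using M'(1) by simp
  qed
  obtain L where "0 < L" and L_Max: "\<forall>X\<in>K. \<forall>Y\<in>K. \<forall>t\<in>{0..T}. Max ((\<lambda>j. \<bar>F X t j - F Y t j\<bar>) ` I) \<le> L * poly_dist N X Y"
    using lipschitz K T unfolding locally_lipschitz_field_def fold by blast
  have L: "\<bar>F X t j - F Y t j\<bar> \<le> L * poly_dist N X Y" if "X \<in> K" "Y \<in> K" "t \<in> {0..T}" "j \<in> I" for X Y t j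
  proof -
    have "\<bar>F X t j - F Y t j\<bar> \<le> Max ((\<lambda>j. \<bar>F X t j - F Y t j\<bar>) ` I)"
      using that(4) by (intro Max_ge) (auto simp: I_def)
    then show ?thesis using L_Max that by force
  qed
  have dist_self: "poly_dist N (\<Gamma> t) (\<Gamma> t) \<le> r" for t
    using r by (simp add: le_iff)
  have bound: "\<bar>F M t j\<bar> \<le> B + L * r" if "M \<in> U" "t \<in> {0..T}" "poly_dist N (\<Gamma> t) M \<le> r" "j \<in> I" for M t j
  proof -
    have "\<bar>F M t j - F (\<Gamma> t) t j\<bar> \<le> L * poly_dist N M (\<Gamma> t)"
      using that by (intro L inK[of _ t] dist_self \<Gamma>) auto
    also have "\<dots> \<le> L * r"
      using that(3) \<open>0 < L\<close> commute[of M "\<Gamma> t"] by (intro mult_left_mono) auto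
    finally show ?thesis using speed[OF that(2,4)] by linarith
  qed
  define E where "E = exp (2 * L * T)"
  define E' where "E' = E * (T * (L + 1))"
  have E: "0 < E" "0 < E'" using T(1) \<open>0 < L\<close> by (auto simp: E_def E'_def)
  have "\<forall>\<^sub>F a in at_right 0. \<eta> a < r / 8 / E'"
    using r E by (intro order_tendstoD(2)[OF lim]) auto
  moreover have "\<forall>\<^sub>F a in at_right 0. a < b" if "0 < b" for b :: real
    using that by (intro eventually_at_rightI[of 0 b]) auto
  then have "\<forall>\<^sub>F a in at_right 0. a < 1 / L" "\<forall>\<^sub>F a in at_right 0. a < r / 2 / (B + L * r)"
    using r B0 \<open>0 < L\<close> by (auto simp: add_nonneg_pos)
  moreover have "\<forall>\<^sub>F a in at_right 0. (0::real) < a"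
    by (rule eventually_at_right_less)
  ultimately have "\<forall>\<^sub>F a in at_right 0. \<eta> a < r / 8 / E' \<and> a < 1 / L \<and> a < r / 2 / (B + L * r) \<and> 0 < a"
    by eventually_elim blast
  then obtain \<tau>star where "\<eta> \<tau>star < r / 8 / E'" "\<tau>star < 1 / L" "\<tau>star < r / 2 / (B + L * r)" "0 < \<tau>star"
    using eventually_happens trivial_limit_at_right_real by blast
  then have \<tau>star: "0 < \<tau>star" "E' * \<eta> \<tau>star \<le> r / 8" "\<tau>star * L \<le> 1" "\<tau>star * (B + L * r) \<le> r / 2"
    using r B0 \<open>0 < L\<close> E by (auto simp: field_simps add_nonneg_pos)
  have \<tau>B: "\<tau>star * B \<le> r / 2"
  proof -
    have "\<tau>star * B \<le> \<tau>star * (B + L * r)"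
      using \<tau>star(1) r \<open>0 < L\<close> by (intro mult_left_mono) auto
    then show ?thesis using \<tau>star(4) by linarith
  qed
  \<comment> \<open>initial and truncation error contribute at most \<open>r/8\<close> each to the final error\<close>
  define \<delta>star where "\<delta>star = r / 8 / E"
  have "0 < \<delta>star" using r E by (simp add: \<delta>star_def)
  have mid_near: "poly_dist N (\<Gamma> ((s + s') / 2)) M \<le> r"
    if st: "0 \<le> s" "s < s'" "s' \<le> T" "s' - s \<le> \<tau>star"
      and G: "poly_dist N (\<Gamma> s) G \<le> r / 4" "poly_dist N G M \<le> r / 4" for s s' G M
    unfolding le_iff
  proof
    fix j assume j: "j \<in> I"
    have "\<bar>height (\<Gamma> s) j - height G j\<bar> \<le> r / 4" "\<bar>height G j - height M j\<bar> \<le> r / 4"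
      using G j unfolding le_iff by auto
    moreover have "\<bar>height (\<Gamma> ((s + s') / 2)) j - height (\<Gamma> s) j\<bar> \<le> r / 2"
    proof -
      have "\<bar>height (\<Gamma> ((s + s') / 2)) j - height (\<Gamma> s) j\<bar> \<le> B * \<bar>(s + s') / 2 - s\<bar>"
        using st j by (intro Lip\<Gamma>) auto
      also have "\<dots> \<le> B * \<tau>star" using st B0 by (intro mult_left_mono) (auto simp: field_simps)
      finally show ?thesis using \<tau>B by (simp add: mult.commute)
    qed
    ultimately show "\<bar>height (\<Gamma> ((s + s') / 2)) j - height M j\<bar> \<le> r" by linarith
  qed
  have step_exists: "\<exists>\<Sigma>\<in>U. scheme_step P U F s s' G \<Sigma> \<and> poly_dist N G \<Sigma> \<le> r / 2 \<and>
      (\<forall>\<Sigma>'\<in>U. scheme_step P U F s s' G \<Sigma>' \<and> poly_dist N G \<Sigma>' \<le> r / 2 \<longrightarrow> \<Sigma>' = \<Sigma>)"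
    if st: "0 \<le> s" "s < s'" "s' \<le> T" "s' - s \<le> \<tau>star" and G: "G \<in> U" "poly_dist N (\<Gamma> s) G \<le> r / 4" for s s' G
  proof (rule unique_implicit_step[OF poly sub, where L = L and B = "B + L * r", unfolded fold])
    have mid: "(s + s') / 2 \<in> {0..T}" using st by auto
    show "G \<in> poly_class P" using G sub by blast
    show "0 < r / 2" using r by simp
    fix M M' j assume M: "M \<in> U" "poly_dist N G M \<le> r / 2 / 2" and j: "j \<in> I"
    have near: "poly_dist N (\<Gamma> ((s + s') / 2)) M \<le> r" using M G by (intro mid_near[OF st]) auto
    show "\<bar>F M ((s + s') / 2) j\<bar> \<le> B + L * r" using bound[OF M(1) mid near j] .
    assume M': "M' \<in> U" "poly_dist N G M' \<le> r / 2 / 2"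
    have "poly_dist N (\<Gamma> ((s + s') / 2)) M' \<le> r" using M' G by (intro mid_near[OF st]) auto
    then show "\<bar>F M ((s + s') / 2) j - F M' ((s + s') / 2) j\<bar> \<le> L * poly_dist N M M'"
      using M M' near mid j by (intro L inK[of _ "(s + s') / 2"])
  next
    fix g assume g: "\<forall>j\<in>I. \<bar>g j - height G j\<bar> \<le> r / 2"
    have "\<forall>j\<in>I. \<bar>g j - height (\<Gamma> s) j\<bar> \<le> r"
    proof
      fix j assume j: "j \<in> I"
      have "\<bar>height (\<Gamma> s) j - height G j\<bar> \<le> r / 4" using G(2) j unfolding le_iff by blast
      with bspec[OF g j] r show "\<bar>g j - height (\<Gamma> s) j\<bar> \<le> r" by linarith
    qed
    then show "\<exists>\<Sigma>\<in>U. \<forall>j\<in>I. height \<Sigma> j = g j" using real[of s g] st K(2) by force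
  next
    have "(s' - s) * L \<le> \<tau>star * L" "(s' - s) * (B + L * r) \<le> \<tau>star * (B + L * r)"
      using st \<open>0 < L\<close> B0 r by (auto intro!: mult_right_mono)
    then show "(s' - s) * L \<le> 1" "(s' - s) * (B + L * r) \<le> r / 2" using \<tau>star by auto
  qed fact
  have step_error: "poly_dist N (\<Gamma> s') \<Sigma> \<le> exp (2 * L * (s' - s)) * (poly_dist N (\<Gamma> s) G + (s' - s) * ((L + 1) * \<eta> a))"
    if st: "0 \<le> s" "s < s'" "s' \<le> T" "s' - s \<le> a" "a \<le> \<tau>star"
      and G: "G \<in> U" "poly_dist N (\<Gamma> s) G \<le> r / 4" and \<Sigma>: "scheme_step P U F s s' G \<Sigma>" "poly_dist N G \<Sigma> \<le> r / 2" for s s' G \<Sigma> a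
  proof -
    define h c where "h = s' - s" and "c = (s + s') / 2"
    define e e' where "e = poly_dist N (\<Gamma> s) G" and "e' = poly_dist N (\<Gamma> s') \<Sigma>"
    have h: "0 < h" "h * L \<le> 1"
    proof -
      have "h * L \<le> \<tau>star * L" using st \<open>0 < L\<close> by (intro mult_right_mono) (auto simp: h_def)
      then show "h * L \<le> 1" using \<tau>star(3) by linarith
    qed (use st in \<open>simp add: h_def\<close>)
    have c: "c \<in> {0..T}" using st by (auto simp: c_def)
    obtain M where M: "M \<in> U" "\<And>j. j \<in> I \<Longrightarrow> height M j = (height G j + height \<Sigma> j) / 2"
      "\<And>j. j \<in> I \<Longrightarrow> (height \<Sigma> j - height G j) / h = F M c j"
      using \<Sigma>(1) unfolding scheme_step_def is_midpoint_def fold h_def c_def by blast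
    have "poly_dist N G M \<le> r / 4"
      unfolding le_iff
    proof
      fix j assume j: "j \<in> I"
      then have "\<bar>height G j - height \<Sigma> j\<bar> \<le> r / 2" using \<Sigma>(2) unfolding le_iff by blast
      then show "\<bar>height G j - height M j\<bar> \<le> r / 4" unfolding M(2)[OF j] by (auto simp: abs_le_iff field_simps)
    qed
    then have M_near: "poly_dist N (\<Gamma> c) M \<le> r"
      unfolding c_def using st G by (intro mid_near) auto
    have mid_dist: "poly_dist N (\<Gamma> c) M \<le> (e + e') / 2 + \<eta> a"
      unfolding le_iff
    proof
      fix j assume j: "j \<in> I"
      have "\<bar>(height (\<Gamma> s) j + height (\<Gamma> s') j) / 2 - height (\<Gamma> c) j\<bar> \<le> \<eta> a"
        unfolding c_def using st j by (intro average) auto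
      moreover have "\<bar>height (\<Gamma> s) j - height G j\<bar> \<le> e" "\<bar>height (\<Gamma> s') j - height \<Sigma> j\<bar> \<le> e'"
        using le_dist[OF j] by (auto simp: e_def e'_def)
      ultimately show "\<bar>height (\<Gamma> c) j - height M j\<bar> \<le> (e + e') / 2 + \<eta> a"
        unfolding M(2)[OF j] abs_le_iff by (simp add: field_simps)
    qed
    have "poly_dist N (\<Gamma> s') \<Sigma> \<le> e + h * (L * ((e + e') / 2) + (L + 1) * \<eta> a)"
      unfolding le_iff
    proof
      fix j assume j: "j \<in> I"
      have 1: "\<bar>height (\<Gamma> s') j - height (\<Gamma> s) j - h * F (\<Gamma> c) c j\<bar> \<le> h * \<eta> a"
        unfolding c_def h_def using st j by (intro trunc) auto
      have "\<bar>F (\<Gamma> c) c j - F M c j\<bar> \<le> L * poly_dist N (\<Gamma> c) M"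
        using c M(1) M_near j by (intro L inK[of _ c] \<Gamma> dist_self)
      also have "\<dots> \<le> L * ((e + e') / 2 + \<eta> a)"
        using mid_dist \<open>0 < L\<close> by (intro mult_left_mono) auto
      finally have "h * \<bar>F (\<Gamma> c) c j - F M c j\<bar> \<le> h * (L * ((e + e') / 2 + \<eta> a))"
        using h(1) by (intro mult_left_mono) auto
      then have 2: "\<bar>h * F (\<Gamma> c) c j - h * F M c j\<bar> \<le> h * (L * ((e + e') / 2 + \<eta> a))"
        using h(1) by (simp add: abs_mult flip: right_diff_distrib)
      have 3: "height \<Sigma> j = height G j + h * F M c j"
        using M(3)[OF j] h(1) by (simp add: field_simps)
      have 4: "\<bar>height (\<Gamma> s) j - height G j\<bar> \<le> e" using le_dist[OF j] by (simp add: e_def)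
      have "h * \<eta> a + e + h * (L * ((e + e') / 2 + \<eta> a)) = e + h * (L * ((e + e') / 2) + (L + 1) * \<eta> a)"
        by (simp add: algebra_simps)
      with 1 2 3 4 show "\<bar>height (\<Gamma> s') j - height \<Sigma> j\<bar> \<le> e + h * (L * ((e + e') / 2) + (L + 1) * \<eta> a)"
        by linarith
    qed
    then have "e' \<le> e + h * (L * ((e + e') / 2) + (L + 1) * \<eta> a)" by (simp only: e'_def)
    then have "e' \<le> exp (2 * L * h) * (e + h * ((L + 1) * \<eta> a))"
      using h \<open>0 < L\<close> \<eta>_nonneg[of a] st by (intro implicit_gronwall_step) (auto simp: e_def)
    then show ?thesis by (simp add: e_def e'_def h_def)
  qed
  have scheme: "\<exists>G. G 0 = \<Gamma>0 \<and> (\<forall>m\<in>{1..mbar}. G m \<in> U) \<and>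
          (\<forall>m<mbar. scheme_step P U F (t m) (t (Suc m)) (G m) (G (Suc m)) \<and> poly_dist N (G m) (G (Suc m)) \<le> r / 2 \<and>
             (\<forall>\<Sigma>\<in>U. scheme_step P U F (t m) (t (Suc m)) (G m) \<Sigma> \<and> poly_dist N (G m) \<Sigma> \<le> r / 2 \<longrightarrow> \<Sigma> = G (Suc m))) \<and>
          Max ((\<lambda>m. poly_dist N (\<Gamma> (t m)) (G m)) ` {..mbar}) \<le> E' * \<eta> \<tau> + E * poly_dist N (\<Gamma> 0) \<Gamma>0"
    if mbar: "1 \<le> mbar" and t: "t 0 = 0" "\<forall>m<mbar. t m < t (Suc m)" "t mbar \<le> T"
      and \<tau>: "\<tau> = Max ((\<lambda>m. t (Suc m) - t m) ` {..<mbar})" "\<tau> \<le> \<tau>star"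
      and \<Gamma>0: "\<Gamma>0 \<in> U" "poly_dist N (\<Gamma> 0) \<Gamma>0 \<le> \<delta>star" for mbar :: nat and t :: "nat \<Rightarrow> real" and \<tau> \<Gamma>0
  proof -
    have step: "t (Suc m) - t m \<le> \<tau>" if "m < mbar" for m
      unfolding \<tau>(1) using that by (intro Max_ge) auto
    have "0 < \<tau>" using step[of 0] t(2) mbar by force
    have t_mono: "t m \<le> t n" if "m \<le> n" "n \<le> mbar" for m n
      using that
    proof (induction n rule: dec_induct)
      case (step n)
      then have "t m \<le> t n" "t n < t (Suc n)" using t(2) by simp_all
      then show ?case by simp
    qed simp
    have t_range: "0 \<le> t m" "t m \<le> T" if "m \<le> mbar" for m
      using t_mono[of 0 m] t_mono[of m mbar] that t by auto
    have \<eta>: "0 \<le> \<eta> \<tau>" "\<eta> \<tau> \<le> \<eta> \<tau>star"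
      using \<eta>_nonneg \<open>0 < \<tau>\<close> mono_onD[OF mono, of \<tau> \<tau>star] \<tau>(2) by auto
    \<comment> \<open>total recursion; the choice is meaningful as long as the error is at most \<open>r/4\<close>\<close>
    define next_polygon where "next_polygon m G = (SOME \<Sigma>. \<Sigma> \<in> U \<and> scheme_step P U F (t m) (t (Suc m)) G \<Sigma> \<and> poly_dist N G \<Sigma> \<le> r / 2 \<and>
      (\<forall>\<Sigma>'\<in>U. scheme_step P U F (t m) (t (Suc m)) G \<Sigma>' \<and> poly_dist N G \<Sigma>' \<le> r / 2 \<longrightarrow> \<Sigma>' = \<Sigma>))" for m G
    define G where "G = rec_nat \<Gamma>0 next_polygon"
    have G_simps: "G 0 = \<Gamma>0" "\<And>m. G (Suc m) = next_polygon m (G m)" by (simp_all add: G_def)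
    define e where "e m = poly_dist N (\<Gamma> (t m)) (G m)" for m
    have e0: "e 0 = poly_dist N (\<Gamma> 0) \<Gamma>0" by (simp add: e_def G_simps t(1))
    have e0_nonneg: "0 \<le> e 0" by (simp add: e_def)
    have G_step: "G (Suc m) \<in> U \<and> scheme_step P U F (t m) (t (Suc m)) (G m) (G (Suc m)) \<and> poly_dist N (G m) (G (Suc m)) \<le> r / 2 \<and>
      (\<forall>\<Sigma>'\<in>U. scheme_step P U F (t m) (t (Suc m)) (G m) \<Sigma>' \<and> poly_dist N (G m) \<Sigma>' \<le> r / 2 \<longrightarrow> \<Sigma>' = G (Suc m))"
      if "m < mbar" "G m \<in> U" "e m \<le> r / 4" for m
    proof -
      have "\<exists>\<Sigma>. \<Sigma> \<in> U \<and> scheme_step P U F (t m) (t (Suc m)) (G m) \<Sigma> \<and> poly_dist N (G m) \<Sigma> \<le> r / 2 \<and>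
        (\<forall>\<Sigma>'\<in>U. scheme_step P U F (t m) (t (Suc m)) (G m) \<Sigma>' \<and> poly_dist N (G m) \<Sigma>' \<le> r / 2 \<longrightarrow> \<Sigma>' = \<Sigma>)"
        using step_exists[of "t m" "t (Suc m)" "G m"] that t(2) t_range(1)[of m] t_range(2)[of "Suc m"] step[of m] \<tau>(2)
        unfolding e_def by auto
      from someI_ex[OF this] show ?thesis unfolding G_simps next_polygon_def .
    qed
    have small: "e m \<le> E' * \<eta> \<tau> + E * e 0 \<and> e m \<le> r / 4"
      if m: "m \<le> mbar" and em: "e m \<le> exp (2 * L * t m) * (e 0 + t m * ((L + 1) * \<eta> \<tau>))" for m
    proof -
      have "exp (2 * L * t m) * (e 0 + t m * ((L + 1) * \<eta> \<tau>)) \<le> E * (e 0 + T * ((L + 1) * \<eta> \<tau>))"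
        unfolding E_def using t_range[OF m] \<eta>(1) \<open>0 < L\<close> e0_nonneg
        by (intro mult_mono add_left_mono mult_right_mono add_nonneg_nonneg mult_nonneg_nonneg) auto
      also have "\<dots> = E' * \<eta> \<tau> + E * e 0" by (simp add: E'_def algebra_simps)
      finally have 1: "e m \<le> E' * \<eta> \<tau> + E * e 0" using em by linarith
      have "E' * \<eta> \<tau> \<le> E' * \<eta> \<tau>star" using \<eta>(2) E by (intro mult_left_mono) auto
      moreover have "E * e 0 \<le> E * \<delta>star" using \<Gamma>0(2) E by (intro mult_left_mono) (auto simp: e0)
      moreover have "E * \<delta>star = r / 8" using E by (simp add: \<delta>star_def)
      ultimately show ?thesis using 1 \<tau>star(2) by linarith
    qed
    have inv: "G m \<in> U \<and> e m \<le> exp (2 * L * t m) * (e 0 + t m * ((L + 1) * \<eta> \<tau>))" if "m \<le> mbar" for m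
      using that
    proof (induction m)
      case 0
      then show ?case using \<Gamma>0(1) by (simp add: G_simps t(1))
    next
      case (Suc m)
      define b where "b = (L + 1) * \<eta> \<tau>"
      have m: "m < mbar" and G: "G m \<in> U" and em: "e m \<le> exp (2 * L * t m) * (e 0 + t m * b)"
        using Suc by (auto simp: b_def)
      have em4: "e m \<le> r / 4" using small[of m] m em by (simp add: b_def)
      have b: "0 \<le> b" using \<eta>(1) \<open>0 < L\<close> by (simp add: b_def)
      define h where "h = t (Suc m) - t m"
      have h: "0 < h" "t (Suc m) = t m + h" using t(2) m by (auto simp: h_def)
      have "e (Suc m) \<le> exp (2 * L * h) * (e m + h * b)"
        unfolding e_def h_def b_def
        using step_error[of "t m" "t (Suc m)" \<tau> "G m" "G (Suc m)"] G_step[OF m G em4] G em4 t(2) m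
          t_range(1)[of m] t_range(2)[of "Suc m"] step[OF m] \<tau>(2) unfolding e_def by auto
      also have "\<dots> \<le> exp (2 * L * h) * (exp (2 * L * t m) * (e 0 + t m * b) + exp (2 * L * t m) * (h * b))"
      proof (intro mult_left_mono add_mono em)
        have "0 \<le> 2 * L * t m" using \<open>0 < L\<close> t_range(1)[of m] m by simp
        then have "1 \<le> exp (2 * L * t m)" by simp
        then show "h * b \<le> exp (2 * L * t m) * (h * b)"
          using h(1) b mult_right_mono[of 1 "exp (2 * L * t m)" "h * b"] by simp
      qed simp
      also have "\<dots> = exp (2 * L * t (Suc m)) * (e 0 + t (Suc m) * b)"
        by (simp add: h(2) exp_add algebra_simps)
      finally show ?case using G_step[OF m G em4] by (simp add: b_def)
    qed
    show ?thesis
    proof (intro exI[of _ G] conjI ballI allI impI)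
      show "G m \<in> U" if "m \<in> {1..mbar}" for m using inv that by auto
      have fin: "e m \<le> E' * \<eta> \<tau> + E * e 0 \<and> e m \<le> r / 4" if "m \<le> mbar" for m
        using small[OF that] inv[OF that] by blast
      show "Max ((\<lambda>m. poly_dist N (\<Gamma> (t m)) (G m)) ` {..mbar}) \<le> E' * \<eta> \<tau> + E * poly_dist N (\<Gamma> 0) \<Gamma>0"
        using fin unfolding e_def[symmetric] e0[symmetric] by (subst Max_le_iff) auto
      fix m assume m: "m < mbar"
      note * = G_step[OF m]
      show "scheme_step P U F (t m) (t (Suc m)) (G m) (G (Suc m))" "poly_dist N (G m) (G (Suc m)) \<le> r / 2"
        using * inv[of m] fin[of m] m by auto
      show "\<Sigma> = G (Suc m)" if "\<Sigma> \<in> U" "scheme_step P U F (t m) (t (Suc m)) (G m) \<Sigma> \<and> poly_dist N (G m) \<Sigma> \<le> r / 2" for \<Sigma>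
        using * inv[of m] fin[of m] m that by auto
    qed (rule G_simps)
  qed
  have "0 < r / 2" using r by simp
  show thesis
    by (rule that[unfolded fold, OF \<open>0 < \<delta>star\<close> \<tau>star(1) E \<open>0 < r / 2\<close>]) (rule scheme; assumption)
qed

section \<open>Convergence of the scheme\<close>

theorem theorem4p7:
  fixes P :: "complex list" and U :: "complex list set" and Tstar :: ereal and T :: real
    and F :: "complex list \<Rightarrow> real \<Rightarrow> nat \<Rightarrow> real" and k :: nat
    and \<Gamma>star :: "complex list" and \<Gamma> :: "real \<Rightarrow> complex list"
  assumes "is_polygon P"
    and "openin (poly_topology P) U"
    and "0 < T" and "ereal T < Tstar"
    and "continuous_field P U Tstar F"
    and "locally_lipschitz_field P U Tstar F"
    and "k \<in> {0, 1, 2}"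
    and "\<Gamma>star \<in> U"
    and "polygonal_motion P (k + 1) {0..T} \<Gamma>"
    and "\<forall>t\<in>{0..T}. \<Gamma> t \<in> U"
    and "\<forall>t\<in>{0..T}. \<forall>j\<in>{1..length P}. normal_velocity {0..T} \<Gamma> j t = F (\<Gamma> t) t j"
    and "\<Gamma> 0 = \<Gamma>star"
  shows "\<exists>\<delta>star>0. \<exists>\<tau>star>0. \<exists>C>0. \<exists>\<rho>>0. \<exists>\<omega> :: real \<Rightarrow> real.
    mono_on {0<..} \<omega> \<and> (\<forall>a>0. \<omega> a > 0) \<and>
    (k \<in> {0, 1} \<longrightarrow> \<omega> \<in> o[at_right 0](\<lambda>a. a ^ k)) \<and>
    (k = 2 \<longrightarrow> \<omega> \<in> O[at_right 0](\<lambda>a. a ^ 2)) \<and>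
    (\<forall>(mbar :: nat) (t :: nat \<Rightarrow> real) (\<tau> :: real) \<Gamma>0.
       1 \<le> mbar \<and> t 0 = 0 \<and> (\<forall>m<mbar. t m < t (Suc m)) \<and> t mbar \<le> T \<and>
       \<tau> = Max ((\<lambda>m. t (Suc m) - t m) ` {..<mbar}) \<and>
       \<Gamma>0 \<in> U \<and> poly_dist (length P) \<Gamma>star \<Gamma>0 \<le> \<delta>star \<and> \<tau> \<le> \<tau>star \<longrightarrow>
       (\<exists>G :: nat \<Rightarrow> complex list.
          G 0 = \<Gamma>0 \<and>
          (\<forall>m\<in>{1..mbar}. G m \<in> U) \<and>
          (\<forall>m<mbar.
             scheme_step P U F (t m) (t (Suc m)) (G m) (G (Suc m)) \<and>
             poly_dist (length P) (G m) (G (Suc m)) \<le> \<rho> \<and>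
             (\<forall>\<Sigma>\<in>U. scheme_step P U F (t m) (t (Suc m)) (G m) \<Sigma> \<and>
                poly_dist (length P) (G m) \<Sigma> \<le> \<rho> \<longrightarrow> \<Sigma> = G (Suc m))) \<and>
          Max ((\<lambda>m. poly_dist (length P) (\<Gamma> (t m)) (G m)) ` {..mbar})
            \<le> \<omega> \<tau> + C * poly_dist (length P) (\<Gamma> 0) \<Gamma>0))"
proof -
  note k = assms(7)
  obtain \<eta> :: "real \<Rightarrow> real" and B where \<eta>: "mono_on {0<..} \<eta>" "\<And>a. 0 < a \<Longrightarrow> 0 \<le> \<eta> a"
    and small_o: "k \<in> {0, 1} \<Longrightarrow> \<eta> \<in> o[at_right 0](\<lambda>a. a ^ k)"
    and big_O: "k = 2 \<Longrightarrow> \<eta> \<in> O[at_right 0](\<lambda>a. a ^ 2)"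
    and bounds: "\<And>t j. \<lbrakk>t \<in> {0..T}; j \<in> {1..length P}\<rbrakk> \<Longrightarrow> \<bar>F (\<Gamma> t) t j\<bar> \<le> B"
    "\<And>s t j. \<lbrakk>s \<in> {0..T}; t \<in> {0..T}; j \<in> {1..length P}\<rbrakk> \<Longrightarrow> \<bar>height (\<Gamma> s) j - height (\<Gamma> t) j\<bar> \<le> B * \<bar>s - t\<bar>"
    and trunc: "\<And>a s s' j. \<lbrakk>0 \<le> s; s < s'; s' \<le> T; s' - s \<le> a; j \<in> {1..length P}\<rbrakk> \<Longrightarrow>
       \<bar>height (\<Gamma> s') j - height (\<Gamma> s) j - (s' - s) * F (\<Gamma> ((s + s') / 2)) ((s + s') / 2) j\<bar> \<le> (s' - s) * \<eta> a"
    "\<And>a s s' j. \<lbrakk>0 \<le> s; s < s'; s' \<le> T; s' - s \<le> a; j \<in> {1..length P}\<rbrakk> \<Longrightarrow>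
       \<bar>(height (\<Gamma> s) j + height (\<Gamma> s') j) / 2 - height (\<Gamma> ((s + s') / 2)) j\<bar> \<le> \<eta> a"
    using motion_truncation_error[where F = F, OF assms(3) k assms(9,11)] by blast
  have power_tendsto: "((\<lambda>a::real. a ^ n) \<longlongrightarrow> 0 ^ n) (at_right 0)" for n
    by (intro tendsto_intros)
  have "\<eta> \<in> o[at_right 0](\<lambda>_. 1)"
  proof (cases "k = 2")
    case True
    have "(\<lambda>a::real. a ^ 2) \<in> o[at_right 0](\<lambda>_. 1)"
      using power_tendsto[of 2] by (intro smalloI_tendsto) auto
    with big_O[OF True] show ?thesis by (rule landau_o.big_small_trans)
  next
    case False
    then have "k \<in> {0, 1}" using k by auto
    moreover have "(\<lambda>a::real. a ^ k) \<in> O[at_right 0](\<lambda>_. 1)"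
      using power_tendsto[of k] by (intro bigoI_tendsto[where c = "0 ^ k"]) auto
    ultimately show ?thesis using small_o landau_o.small_big_trans by blast
  qed
  then have lim: "(\<eta> \<longlongrightarrow> 0) (at_right 0)"
    using smalloD_tendsto by fastforce
  have \<Gamma>U: "\<And>t. t \<in> {0..T} \<Longrightarrow> \<Gamma> t \<in> U" using assms(10) by blast
  show ?thesis
  proof (rule implicit_scheme_converges[OF assms(1-4) assms(6)])
    fix \<delta>star \<tau>star C C' \<rho> :: real
    assume pos: "0 < \<delta>star" "0 < \<tau>star" "0 < C" "0 < C'" "0 < \<rho>"
      and conv: "\<And>(mbar :: nat) (t :: nat \<Rightarrow> real) (\<tau> :: real) \<Gamma>0.
       \<lbrakk>1 \<le> mbar; t 0 = 0; \<forall>m<mbar. t m < t (Suc m); t mbar \<le> T;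
        \<tau> = Max ((\<lambda>m. t (Suc m) - t m) ` {..<mbar}); \<tau> \<le> \<tau>star;
        \<Gamma>0 \<in> U; poly_dist (length P) (\<Gamma> 0) \<Gamma>0 \<le> \<delta>star\<rbrakk> \<Longrightarrow>
       \<exists>G :: nat \<Rightarrow> complex list.
          G 0 = \<Gamma>0 \<and>
          (\<forall>m\<in>{1..mbar}. G m \<in> U) \<and>
          (\<forall>m<mbar.
             scheme_step P U F (t m) (t (Suc m)) (G m) (G (Suc m)) \<and>
             poly_dist (length P) (G m) (G (Suc m)) \<le> \<rho> \<and>
             (\<forall>\<Sigma>\<in>U. scheme_step P U F (t m) (t (Suc m)) (G m) \<Sigma> \<and>
                poly_dist (length P) (G m) \<Sigma> \<le> \<rho> \<longrightarrow> \<Sigma> = G (Suc m))) \<and>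
          Max ((\<lambda>m. poly_dist (length P) (\<Gamma> (t m)) (G m)) ` {..mbar})
            \<le> C' * \<eta> \<tau> + C * poly_dist (length P) (\<Gamma> 0) \<Gamma>0"
    \<comment> \<open>the power only makes \<open>\<omega>\<close> positive; it has a higher order than required\<close>
  define \<omega> where "\<omega> a = C' * \<eta> a + a ^ (k + 1)" for a
    have power: "(\<lambda>a::real. a ^ (k + 1)) \<in> o[at_right 0](\<lambda>a. a ^ k)"
    proof (rule smalloI_tendsto)
      have "\<forall>\<^sub>F a in at_right 0. (a::real) = a ^ (k + 1) / a ^ k"
        by (intro eventually_at_rightI[of 0 1]) auto
      then show "((\<lambda>a::real. a ^ (k + 1) / a ^ k) \<longlongrightarrow> 0) (at_right 0)"
        by (rule Lim_transform_eventually[OF tendsto_ident_at])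
      show "\<forall>\<^sub>F a in at_right 0. (a::real) ^ k \<noteq> 0" by (intro eventually_at_rightI[of 0 1]) auto
    qed
    have \<omega>_mono: "mono_on {0<..} \<omega>"
      using \<eta>(1) pos(4) by (auto simp: \<omega>_def mono_on_def intro!: add_mono mult_left_mono mult_mono power_mono)
    have \<omega>_pos: "\<forall>a>0. \<omega> a > 0"
      using \<eta>(2) pos(4) by (simp add: \<omega>_def add_nonneg_pos)
    have \<omega>_o: "k \<in> {0, 1} \<longrightarrow> \<omega> \<in> o[at_right 0](\<lambda>a. a ^ k)"
      unfolding \<omega>_def using small_o power pos(4) by (auto intro!: sum_in_smallo)
    have \<omega>_O: "k = 2 \<longrightarrow> \<omega> \<in> O[at_right 0](\<lambda>a. a ^ 2)"
    proof
      assume k2: "k = 2"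
      have "(\<lambda>a::real. a ^ (k + 1)) \<in> O[at_right 0](\<lambda>a. a ^ 2)"
        using landau_o.small_imp_big[OF power] by (simp only: k2)
      moreover have "(\<lambda>a. C' * \<eta> a) \<in> O[at_right 0](\<lambda>a. a ^ 2)"
        using big_O[OF k2] by simp
      ultimately show "\<omega> \<in> O[at_right 0](\<lambda>a. a ^ 2)"
        unfolding \<omega>_def by (rule sum_in_bigo(1)[rotated])
    qed
    have le: "C' * \<eta> \<tau> \<le> \<omega> \<tau>" if "0 < \<tau>" for \<tau>
      using that by (simp add: \<omega>_def)
    show ?thesis
      unfolding assms(12)[symmetric]
    proof (rule exI[of _ \<delta>star], rule conjI[OF pos(1)], rule exI[of _ \<tau>star], rule conjI[OF pos(2)],
        rule exI[of _ C], rule conjI[OF pos(3)], rule exI[of _ \<rho>], rule conjI[OF pos(5)], rule exI[of _ \<omega>],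
        intro conjI \<omega>_mono \<omega>_pos \<omega>_o \<omega>_O allI, rule impI, elim conjE)
      fix mbar :: nat and t :: "nat \<Rightarrow> real" and \<tau> :: real and \<Gamma>0
      assume data: "1 \<le> mbar" "t 0 = 0" "\<forall>m<mbar. t m < t (Suc m)" "t mbar \<le> T"
        "\<tau> = Max ((\<lambda>m. t (Suc m) - t m) ` {..<mbar})"
        "\<Gamma>0 \<in> U" "poly_dist (length P) (\<Gamma> 0) \<Gamma>0 \<le> \<delta>star" "\<tau> \<le> \<tau>star"
      have "t 1 - t 0 \<le> \<tau>"
        unfolding data(5) using data(1) by (intro Max_ge) auto
      moreover have "t 0 < t 1" using data(1,3) by simp
      ultimately have "0 < \<tau>" by linarith
      obtain G where G: "G 0 = \<Gamma>0" "\<forall>m\<in>{1..mbar}. G m \<in> U"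
        "\<forall>m<mbar. scheme_step P U F (t m) (t (Suc m)) (G m) (G (Suc m)) \<and>
             poly_dist (length P) (G m) (G (Suc m)) \<le> \<rho> \<and>
             (\<forall>\<Sigma>\<in>U. scheme_step P U F (t m) (t (Suc m)) (G m) \<Sigma> \<and>
                poly_dist (length P) (G m) \<Sigma> \<le> \<rho> \<longrightarrow> \<Sigma> = G (Suc m))"
        and error: "Max ((\<lambda>m. poly_dist (length P) (\<Gamma> (t m)) (G m)) ` {..mbar})
            \<le> C' * \<eta> \<tau> + C * poly_dist (length P) (\<Gamma> 0) \<Gamma>0"
        using conv[OF data(1-5,8,6,7)] by - (elim exE conjE, rule that; assumption)
      have "Max ((\<lambda>m. poly_dist (length P) (\<Gamma> (t m)) (G m)) ` {..mbar})
          \<le> \<omega> \<tau> + C * poly_dist (length P) (\<Gamma> 0) \<Gamma>0"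
        using error le[OF \<open>0 < \<tau>\<close>] by linarith
      with G show "\<exists>G. G 0 = \<Gamma>0 \<and> (\<forall>m\<in>{1..mbar}. G m \<in> U) \<and>
          (\<forall>m<mbar.
             scheme_step P U F (t m) (t (Suc m)) (G m) (G (Suc m)) \<and>
             poly_dist (length P) (G m) (G (Suc m)) \<le> \<rho> \<and>
             (\<forall>\<Sigma>\<in>U. scheme_step P U F (t m) (t (Suc m)) (G m) \<Sigma> \<and>
                poly_dist (length P) (G m) \<Sigma> \<le> \<rho> \<longrightarrow> \<Sigma> = G (Suc m))) \<and>
          Max ((\<lambda>m. poly_dist (length P) (\<Gamma> (t m)) (G m)) ` {..mbar})
            \<le> \<omega> \<tau> + C * poly_dist (length P) (\<Gamma> 0) \<Gamma>0"
        by (intro exI[of _ G] conjI)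
    qed
  qed (fact \<Gamma>U bounds \<eta> lim trunc)+
qed

end
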